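(* Every closed term of the braided lambda calculus (i.e. every term $M$ with $\vdash M$ derivable with empty context) is $\beta\eta$-equal to a term built by application only from the four closed terms $\mathbf{B}$, $\mathbf{I}$, $\mathbf{C}^+$ and $\mathbf{C}^-$.
   Context: Braid groups. $B_n$ is the Artin braid group with generators $\sigma_1,\dots,\sigma_{n-1}$ and relations $\sigma_i\sigma_j=\sigma_j\sigma_i$ for $|i-j|\ge 2$ and $\sigma_i\sigma_{i+1}\sigma_i=\sigma_{i+1}\sigma_i\sigma_{i+1}$ ($1\le i\le n-2$); $B_0,B_1$ are trivial. The unit of $B_n$ is written $e$ or $\mathrm{id}_n$. Elements of $B_n$ are called braids with $n$ strands. Each $s\in B_n$ induces a permutation $i\mapsto s(i)$ of $\{1,\dots,n\}$, where $\sigma_j^{\pm1}$ induces the transposition $(j\ j{+}1)$ and $(ss')(i)=s'(s(i))$. For $s\in B_n$, $s'\in B_m$, the parallel composition $s\otimes s'\in B_{n+m}$ is $s$ on the first $n$ strands and $s'$ on the last $m$ strands (so $\sigma_j$ in $s'$ becomes $\sigma_{n+j}$). Terms. Contexts are finite lists of distinct variables; terms are taken up to renaming of bound variables. Judgements $\Gamma\vdash M$ are derived by: $x\vdash x$; if $\Gamma,x\vdash M$ then $\Gamma\vdash\lambda x.M$; if $\Gamma\vdash M$ and $\Gamma'\vdash N$ (disjoint contexts) then $\Gamma,\Gamma'\vdash M\,N$; if $x_1,\dots,x_n\vdash M$ and $s\in B_n$ then $x_{s(1)},\dots,x_{s(n)}\vdash[s]M$. Substitution on braids. For $1\le i\le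 n$, $m\ge0$, the map $(-)[i:=m]:B_n\to B_{n+m-1}$ (replacing the strand starting at position $i$ by $m$ parallel strands) is defined by $e[i:=m]=e$; $(\sigma_js)[i:=m]=\sigma_{j+m-1}(s[i:=m])$ if $i\le j-1$; $(\sigma_js)[i:=m]=\sigma_j(s[i:=m])$ if $i\ge j+2$; $(\sigma_js)[j:=m]=\sigma_{j+m-1}\cdots\sigma_{j+1}\sigma_j(s[j{+}1:=m])$ for $m\geq1$ and $=s[j{+}1:=0]$ for $m=0$; $(\sigma_js)[j{+}1:=m]=\sigma_j\sigma_{j+1}\cdots\sigma_{j+m-1}(s[j:=m])$ for $m\ge1$ and $=s[j:=0]$ for $m=0$; and the same clauses for $\sigma_j^{-1}s$ with every displayed generator replaced by its inverse (in the same order). Substitution on terms. $M[x:=N]$ is the usual capture-avoiding replacement of the unique free occurrence of $x$ on variables, abstractions and applications, and, if $x_1,\dots,x_n\vdash M$, $s\in B_n$ and $N$ has $m$ free variables, $([s]M)[x_i:=N]=\big[s[s^{-1}(i):=m]\big](M[x_i:=N])$. Equality. $=_{\beta\eta}$ is the smallest congruence on terms (braids being elements of $B_n$) containing: $(\lambda x.M)N=M[x:=N]$; $\lambda x.M\,x=M$; $[\mathrm{id}_n]M=M$; $[s]([s']M)=[ss']M$; $([s]M)([s']N)=[s\otimes s'](M\,N)$; $[s](\lambda x.M)=\lambda x.[s\otimes\mathrm{id}_1]M$. Combinators. $\mathbf{I}=\lambda x.x$, $\mathbf{B}=\lambda xyz.x\,(y\,z)$, $\mathbf{C}^+=\lambda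 fxy.[\mathrm{id}_1\otimes\sigma_1](f\,y\,x)$, $\mathbf{C}^-=\lambda fxy.[\mathrm{id}_1\otimes\sigma_1^{-1}](f\,y\,x)$ (here $f,y,x\vdash f\,y\,x$ and the braid is in $B_3$). *)

theory Defs
  imports Main "HOL-Combinatorics.Transposition"
begin

section \<open>Braid groups\<close>

text \<open>The letter \<open>(j, True)\<close> stands for \<open>\<sigma>\<^sub>j\<close> and \<open>(j, False)\<close> for its inverse.\<close>

type_synonym word = "(nat \<times> bool) list"

definition braid_word :: "nat \<Rightarrow> word \<Rightarrow> bool" where
  "braid_word n w \<longleftrightarrow> (\<forall>(j, b) \<in> set w. 1 \<le> j \<and> j < n)"

inductive braid_relator :: "nat \<Rightarrow> word \<Rightarrow> word \<Rightarrow> bool" for n where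
  cancel: "1 \<le> j \<Longrightarrow> j < n \<Longrightarrow> braid_relator n [(j, b), (j, \<not> b)] []"
| far: "1 \<le> i \<Longrightarrow> i + 2 \<le> j \<Longrightarrow> j < n \<Longrightarrow>
    braid_relator n [(i, True), (j, True)] [(j, True), (i, True)]"
| braid: "1 \<le> i \<Longrightarrow> i + 1 < n \<Longrightarrow>
    braid_relator n [(i, True), (i + 1, True), (i, True)]
                    [(i + 1, True), (i, True), (i + 1, True)]"

inductive braid_eq :: "nat \<Rightarrow> word \<Rightarrow> word \<Rightarrow> bool" for n where
  refl: "braid_word n w \<Longrightarrow> braid_eq n w w"
| sym: "braid_eq n w v \<Longrightarrow> braid_eq n v w"
| trans: "braid_eq n w v \<Longrightarrow> braid_eq n v u \<Longrightarrow> braid_eq n w u"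
| step: "braid_relator n l r \<Longrightarrow> braid_word n u \<Longrightarrow> braid_word n v \<Longrightarrow>
    braid_eq n (u @ l @ v) (u @ r @ v)"

lemma braid_word_simps [simp]:
  "braid_word n []"
  "braid_word n (g # w) \<longleftrightarrow> 1 \<le> fst g \<and> fst g < n \<and> braid_word n w"
  "braid_word n (w @ v) \<longleftrightarrow> braid_word n w \<and> braid_word n v"
  by (auto simp: braid_word_def)

lemma braid_relator_word: "braid_relator n l r \<Longrightarrow> braid_word n l \<and> braid_word n r"
  by (induction rule: braid_relator.induct) auto

lemma braid_eq_word: "braid_eq n w v \<Longrightarrow> braid_word n w \<and> braid_word n v"
  by (induction rule: braid_eq.induct) (auto dest: braid_relator_word)

lemma braid_eq_context:
  assumes "braid_eq n w v" "braid_word n a" "braid_word n b"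
  shows "braid_eq n (a @ w @ b) (a @ v @ b)"
  using assms
proof (induction rule: braid_eq.induct)
  case (step l r u v)
  then show ?case
    using braid_eq.step[of n l r "a @ u" "v @ b"] by simp
qed (auto intro: braid_eq.intros)

lemma braid_eq_append:
  assumes "braid_eq n w w'" "braid_eq n v v'"
  shows "braid_eq n (w @ v) (w' @ v')"
proof -
  have "braid_eq n (w @ v) (w' @ v)"
    using braid_eq_context[OF assms(1), of "[]" v] braid_eq_word[OF assms(2)] by simp
  moreover have "braid_eq n (w' @ v) (w' @ v')"
    using braid_eq_context[OF assms(2), of w' "[]"] braid_eq_word[OF assms(1)] by simp
  ultimately show ?thesis by (rule braid_eq.trans)
qed

text \<open>A braid carries its number of strands; the elements of \<open>B\<^sub>n\<close> are the braids \<open>s\<close>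
  with \<open>strands s = n\<close>.\<close>

definition braid_rel :: "nat \<times> word \<Rightarrow> nat \<times> word \<Rightarrow> bool" where
  "braid_rel p q \<longleftrightarrow> fst p = fst q \<and> braid_eq (fst p) (snd p) (snd q)"

quotient_type braid = "nat \<times> word" / partial: braid_rel
proof (rule part_equivpI)
  show "\<exists>p. braid_rel p p"
    by (rule exI[of _ "(0, [])"]) (auto simp: braid_rel_def intro: braid_eq.refl)
qed (auto simp: braid_rel_def symp_def transp_def intro: braid_eq.sym braid_eq.trans)

lift_definition strands :: "braid \<Rightarrow> nat" is fst
  by (simp add: braid_rel_def)

lift_definition braid_one :: "nat \<Rightarrow> braid" is "\<lambda>n. (n, [])"
  by (simp add: braid_rel_def braid_eq.refl)

lift_definition braid_gen :: "nat \<Rightarrow> nat \<Rightarrow> bool \<Rightarrow> braid"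
  is "\<lambda>n j b. (n, if 1 \<le> j \<and> j < n then [(j, b)] else [])"
  by (simp add: braid_rel_def braid_eq.refl)

text \<open>The product \<open>s s'\<close> of \<open>B\<^sub>n\<close>; its value is only meaningful if both factors have the same
  number of strands.\<close>

lift_definition braid_mult :: "braid \<Rightarrow> braid \<Rightarrow> braid" (infixl "\<odot>" 70)
  is "\<lambda>(n, w) (m, v). (n, if n = m then w @ v else w)"
  by (auto simp: braid_rel_def intro: braid_eq_append)

definition shift_word :: "nat \<Rightarrow> word \<Rightarrow> word" where
  "shift_word k w = map (\<lambda>(j, b). (k + j, b)) w"

lemma braid_word_mono: "braid_word n w \<Longrightarrow> n \<le> m \<Longrightarrow> braid_word m w"
  by (auto simp: braid_word_def)

lemma braid_word_shift: "braid_word m w \<Longrightarrow> braid_word (n + m) (shift_word n w)"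
  by (auto simp: braid_word_def shift_word_def)

lemma braid_eq_mono:
  assumes "braid_eq n w v" "n \<le> m"
  shows "braid_eq m w v"
  using assms
proof (induction rule: braid_eq.induct)
  case (step l r u v)
  have "braid_relator m l r"
    using step(1)
  proof cases
    case (cancel j b)
    then show ?thesis using step.prems by (auto intro: braid_relator.cancel)
  next
    case (far i j)
    then show ?thesis using step.prems by (auto intro: braid_relator.far)
  next
    case (braid i)
    then show ?thesis using step.prems braid_relator.braid[of i m] by simp
  qed
  then show ?case using step by (auto intro: braid_eq.step braid_word_mono)
qed (auto intro: braid_eq.intros braid_word_mono)

lemma braid_eq_shift:
  assumes "braid_eq m w v"
  shows "braid_eq (n + m) (shift_word n w) (shift_word n v)"
  using assms
proof (induction rule: braid_eq.induct)
  case (step l r u v)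
  have "braid_relator (n + m) (shift_word n l) (shift_word n r)"
    using step(1)
  proof cases
    case (cancel j b)
    then show ?thesis
      using braid_relator.cancel[of "n + j" "n + m" b] by (simp add: shift_word_def)
  next
    case (far i j)
    then show ?thesis
      using braid_relator.far[of "n + i" "n + j" "n + m"] by (simp add: shift_word_def)
  next
    case (braid i)
    then show ?thesis
      using braid_relator.braid[of "n + i" "n + m"] by (simp add: shift_word_def)
  qed
  from braid_eq.step[OF this braid_word_shift[OF step(2)] braid_word_shift[OF step(3)]]
  show ?case by (simp add: shift_word_def)
qed (auto intro: braid_eq.intros braid_word_shift)

lift_definition braid_tensor :: "braid \<Rightarrow> braid \<Rightarrow> braid" (infixl "\<otimes>\<^sub>b" 70)
  is "\<lambda>(n, w) (m, v). (n + m, w @ shift_word n v)"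
  by (auto simp: braid_rel_def intro!: braid_eq_append braid_eq_shift intro: braid_eq_mono[OF _ le_add1])

text \<open>The permutation \<open>i \<mapsto> s(i)\<close>, extended by the identity outside \<open>{1..n}\<close>.\<close>

fun word_perm :: "word \<Rightarrow> nat \<Rightarrow> nat" where
  "word_perm [] i = i"
| "word_perm ((j, b) # w) i = word_perm w (transpose j (Suc j) i)"

lemma word_perm_append [simp]: "word_perm (w @ v) i = word_perm v (word_perm w i)"
  by (induction w i rule: word_perm.induct) auto

lemma word_perm_eq: "braid_eq n w v \<Longrightarrow> word_perm w = word_perm v"
proof (induction rule: braid_eq.induct)
  case (step l r u v)
  have "word_perm l i = word_perm r i" for i
    using step(1) by cases (auto simp: transpose_def)
  then show ?case by auto
qed auto

lift_definition braid_perm :: "braid \<Rightarrow> nat \<Rightarrow> nat" is "\<lambda>(n, w). word_perm w"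
  by (auto simp: braid_rel_def dest: word_perm_eq)

lemma bij_word_perm: "bij (word_perm w)"
proof (induction w)
  case Nil
  have "word_perm [] = id" by auto
  then show ?case by (metis bij_id)
next
  case (Cons g w)
  obtain j b where g: "g = (j, b)" by force
  have "word_perm (g # w) = word_perm w \<circ> transpose j (Suc j)" by (auto simp: g)
  then show ?case using Cons by (metis bij_comp bij_transpose)
qed

lemma bij_braid_perm: "bij (braid_perm s)"
  by transfer (auto simp: bij_word_perm)

lemma word_perm_range:
  "braid_word n w \<Longrightarrow> 1 \<le> i \<Longrightarrow> i \<le> n \<Longrightarrow> 1 \<le> word_perm w i \<and> word_perm w i \<le> n"
  by (induction w i rule: word_perm.induct) (auto simp: transpose_def)

text \<open>Replacing the strand that starts at position \<open>i\<close> by \<open>m\<close> parallel strands. For \<open>m = 0\<close> the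
  two block words below are empty.\<close>

abbreviation letters :: "bool \<Rightarrow> nat list \<Rightarrow> word" where
  "letters b ks \<equiv> map (\<lambda>k. (k, b)) ks"

fun word_cable :: "word \<Rightarrow> nat \<Rightarrow> nat \<Rightarrow> word" where
  "word_cable [] i m = []"
| "word_cable ((j, b) # w) i m =
    (if i < j then (j + m - 1, b) # word_cable w i m
     else if Suc j < i then (j, b) # word_cable w i m
     else if i = j then letters b (rev [j..<j + m]) @ word_cable w (Suc j) m
     else letters b [j..<j + m] @ word_cable w j m)"

lemma word_cable_append:
  "word_cable (w @ v) i m = word_cable w i m @ word_cable v (word_perm w i) m"
  by (induction w i rule: word_perm.induct) (auto simp: transpose_def not_less)

lemma braid_word_letters [simp]:
  "braid_word n (letters b ks) \<longleftrightarrow> (\<forall>k \<in> set ks. 1 \<le> k \<and> k < n)"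
  by (auto simp: braid_word_def)

lemma braid_word_rev [simp]: "braid_word n (rev w) \<longleftrightarrow> braid_word n w"
  by (simp add: braid_word_def)

lemma word_cable_word:
  "braid_word n w \<Longrightarrow> 1 \<le> i \<Longrightarrow> i \<le> n \<Longrightarrow> braid_word (n + m - 1) (word_cable w i m)"
  by (induction w i m rule: word_cable.induct) auto

lemma braid_eq_rev: "braid_eq n w v \<Longrightarrow> braid_eq n (rev w) (rev v)"
proof (induction rule: braid_eq.induct)
  case (step l r u v)
  have "braid_eq n (rev l) (rev r)"
    using step(1)
  proof cases
    case (cancel j b)
    then show ?thesis
      using braid_eq.step[OF braid_relator.cancel[of j n "\<not> b"], of "[]" "[]"] by simp
  next
    case (far i j)
    then show ?thesis
      using braid_eq.step[OF braid_relator.far[of i j n], of "[]" "[]"] by (auto intro: braid_eq.sym)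
  next
    case (braid i)
    then show ?thesis
      using braid_eq.step[OF braid_relator.braid[of i n], of "[]" "[]"] by simp
  qed
  from braid_eq_context[OF this, of "rev v" "rev u"] step(2,3) show ?case by simp
qed (auto intro: braid_eq.intros)

lemma far_letters:
  assumes "\<And>k. k \<in> set ks \<Longrightarrow> 1 \<le> k \<and> k < n \<and> (k + 2 \<le> j \<or> j + 2 \<le> k)" "1 \<le> j" "j < n"
  shows "braid_eq n (letters True ks @ [(j, True)]) ((j, True) # letters True ks)"
  using assms(1)
proof (induction ks)
  case Nil
  then show ?case using assms by (auto intro: braid_eq.refl)
next
  case (Cons k ks)
  have k: "1 \<le> k" "k < n" "k + 2 \<le> j \<or> j + 2 \<le> k" using Cons.prems[of k] by auto
  have 1: "braid_eq n ([(k, True)] @ (letters True ks @ [(j, True)]) @ [])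
                      ([(k, True)] @ ((j, True) # letters True ks) @ [])"
    by (rule braid_eq_context) (use Cons k in auto)
  have "braid_eq n ([] @ [(k, True), (j, True)] @ letters True ks)
                   ([] @ [(j, True), (k, True)] @ letters True ks)"
  proof (cases "k + 2 \<le> j")
    case True
    then show ?thesis
      by (intro braid_eq.step braid_relator.far) (use k assms Cons.prems in auto)
  next
    case False
    then show ?thesis
      by (intro braid_eq.sym[OF braid_eq.step] braid_relator.far) (use k assms Cons.prems in auto)
  qed
  with 1 show ?case by (auto intro: braid_eq.trans)
qed

lemma telescope:
  assumes "\<And>k. k \<in> set ks \<Longrightarrow> 1 \<le> k \<and> k < n"
  shows "braid_eq n (letters b (rev ks) @ letters (\<not> b) ks) []"
  using assms
proof (induction ks)
  case Nil
  then show ?case by (auto intro: braid_eq.refl)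
next
  case (Cons k ks)
  have "braid_eq n (letters b (rev ks) @ [(k, b), (k, \<not> b)] @ letters (\<not> b) ks)
                   (letters b (rev ks) @ [] @ letters (\<not> b) ks)"
    by (intro braid_eq.step braid_relator.cancel) (use Cons in auto)
  with Cons show ?case by (auto intro: braid_eq.trans)
qed

lemma block_slide_down:
  assumes "1 \<le> j" "j + m < n"
  shows "braid_eq n
    (letters True (rev [j..<j + m]) @ letters True (rev [Suc j..<Suc j + m]) @ [(j, True)])
    ((j + m, True) # letters True (rev [j..<j + m]) @ letters True (rev [Suc j..<Suc j + m]))"
  using assms
proof (induction m)
  case 0
  then show ?case by (auto intro: braid_eq.refl)
next
  case (Suc m)
  define D where "D = letters True (rev [j..<j + m])"
  define E where "E = letters True (rev [Suc j..<Suc j + m])"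
  let ?a = "(j + m, True)" and ?b = "(Suc (j + m), True)"
  have w [simp]: "braid_word n D" "braid_word n E"
    using Suc.prems by (auto simp: D_def E_def)
  have j: "1 \<le> j" "j < n" "j + m < n" "Suc (j + m) < n" using Suc.prems by auto
  have far: "braid_eq n (D @ [?b]) (?b # D)"
    unfolding D_def by (rule far_letters) (use Suc.prems in auto)
  have ih: "braid_eq n (D @ E @ [(j, True)]) (?a # D @ E)"
    unfolding D_def E_def by (rule Suc.IH) (use Suc.prems in auto)
  have br: "braid_eq n (?a # ?b # ?a # D @ E) (?b # ?a # ?b # D @ E)"
    using braid_eq.step[OF braid_relator.braid[of "j + m" n], of "[]" "D @ E"] j by simp
  have 1: "braid_eq n (?a # D @ ?b # E @ [(j, True)]) (?a # ?b # D @ E @ [(j, True)])"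
    using braid_eq_context[OF far, of "[?a]" "E @ [(j, True)]"] j by simp
  have 2: "braid_eq n (?a # ?b # D @ E @ [(j, True)]) (?a # ?b # ?a # D @ E)"
    using braid_eq_context[OF ih, of "[?a, ?b]" "[]"] j by simp
  have 3: "braid_eq n (?b # ?a # ?b # D @ E) (?b # ?a # D @ ?b # E)"
    using braid_eq_context[OF braid_eq.sym[OF far], of "[?b, ?a]" E] j by simp
  have "letters True (rev [j..<j + Suc m]) = ?a # D"
    "letters True (rev [Suc j..<Suc j + Suc m]) = ?b # E"
    by (simp_all add: D_def E_def)
  then show ?case
    using braid_eq.trans[OF 1 braid_eq.trans[OF 2 braid_eq.trans[OF br 3]]] by simp
qed

lemma block_slide_up:
  assumes "1 \<le> j" "j + m < n"
  shows "braid_eq n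
    ((j, True) # letters True [Suc j..<Suc j + m] @ letters True [j..<j + m])
    (letters True [Suc j..<Suc j + m] @ letters True [j..<j + m] @ [(j + m, True)])"
  using braid_eq_rev[OF block_slide_down[OF assms]] by (simp add: rev_map del: upt_Suc)

lemma block_slide_mid:
  assumes "1 \<le> j" "j + m < n"
  shows "braid_eq n
    (letters True [j..<j + m] @ (j + m, True) # letters True (rev [j..<j + m]))
    (letters True (rev [Suc j..<Suc j + m]) @ (j, True) # letters True [Suc j..<Suc j + m])"
  using assms
proof (induction m)
  case 0
  then show ?case by (auto intro: braid_eq.refl)
next
  case (Suc m)
  define U where "U = letters True [j..<j + m]"
  define V where "V = letters True [Suc j..<Suc j + m]"
  define D where "D = letters True (rev [j..<j + m])"
  define E where "E = letters True (rev [Suc j..<Suc j + m])"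
  let ?a = "(j + m, True)" and ?b = "(Suc (j + m), True)"
  have w [simp]: "braid_word n D" "braid_word n E" "braid_word n U" "braid_word n V"
    using Suc.prems by (auto simp: D_def E_def U_def V_def)
  have j: "1 \<le> j" "j < n" "j + m < n" "Suc (j + m) < n" using Suc.prems by auto
  have farU: "braid_eq n (U @ [?b]) (?b # U)" and farD: "braid_eq n (D @ [?b]) (?b # D)"
    unfolding U_def D_def by (rule far_letters; use Suc.prems in auto)+
  have ih: "braid_eq n (U @ ?a # D) (E @ (j, True) # V)"
    unfolding U_def V_def D_def E_def by (rule Suc.IH) (use Suc.prems in auto)
  have 1: "braid_eq n (U @ ?a # ?b # ?a # D) (U @ ?b # ?a # ?b # D)"
    using braid_eq.step[OF braid_relator.braid[of "j + m" n], of U D] j by simp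
  have 2: "braid_eq n (U @ ?b # ?a # ?b # D) (?b # U @ ?a # ?b # D)"
    using braid_eq_context[OF farU, of "[]" "?a # ?b # D"] j by simp
  have 3: "braid_eq n (?b # U @ ?a # ?b # D) (?b # U @ ?a # D @ [?b])"
    using braid_eq_context[OF braid_eq.sym[OF farD], of "?b # U @ [?a]" "[]"] j by simp
  have 4: "braid_eq n (?b # U @ ?a # D @ [?b]) (?b # E @ (j, True) # V @ [?b])"
    using braid_eq_context[OF ih, of "[?b]" "[?b]"] j by simp
  have "letters True [j..<j + Suc m] = U @ [?a]"
    "letters True [Suc j..<Suc j + Suc m] = V @ [?b]"
    "letters True (rev [j..<j + Suc m]) = ?a # D"
    "letters True (rev [Suc j..<Suc j + Suc m]) = ?b # E"
    by (simp_all add: U_def V_def D_def E_def)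
  then show ?case
    using braid_eq.trans[OF 1 braid_eq.trans[OF 2 braid_eq.trans[OF 3 4]]] by simp
qed

lemma word_cable_relator:
  assumes "braid_relator n l r" "1 \<le> i" "i \<le> n"
  shows "braid_eq (n + m - 1) (word_cable l i m) (word_cable r i m)"
  using assms(1)
proof cases
  case (cancel j b)
  consider "i < j" | "i = j" | "i = Suc j" | "Suc j < i" by linarith
  then show ?thesis
  proof cases
    case 1
    then show ?thesis
      using cancel assms braid_eq.step[OF braid_relator.cancel[of "j + m - 1" "n + m - 1" b], of "[]" "[]"]
      by auto
  next
    case 2
    moreover have "braid_eq (n + m - 1) (letters b (rev [j..<j + m]) @ letters (\<not> b) [j..<j + m]) []"
      by (rule telescope) (use cancel in auto)
    ultimately show ?thesis using cancel by simp
  next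
    case 3
    moreover have "braid_eq (n + m - 1) (letters b (rev (rev [j..<j + m])) @ letters (\<not> b) (rev [j..<j + m])) []"
      by (rule telescope) (use cancel in auto)
    ultimately show ?thesis using cancel by simp
  next
    case 4
    then show ?thesis
      using cancel assms braid_eq.step[OF braid_relator.cancel[of j "n + m - 1" b], of "[]" "[]"]
      by auto
  qed
next
  case (far a c)
  have *: "braid_eq (n + m - 1) [(a', True), (c', True)] [(c', True), (a', True)]"
    if "1 \<le> a'" "a' + 2 \<le> c'" "c' < n + m - 1" for a' c'
    using braid_eq.step[OF braid_relator.far[OF that], of "[]" "[]"] by simp
  consider "i < a" | "i = a" | "i = Suc a" | "Suc a < i" "i < c" | "i = c" | "i = Suc c" | "Suc c < i"
    by linarith
  then show ?thesis
  proof cases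
    case 1
    then show ?thesis using far assms *[of "a + m - 1" "c + m - 1"] by auto
  next
    case 2
    moreover have "braid_eq (n + m - 1) (letters True (rev [a..<a + m]) @ [(c + m - 1, True)])
        ((c + m - 1, True) # letters True (rev [a..<a + m]))"
      by (rule far_letters) (use far in auto)
    ultimately show ?thesis using far by auto
  next
    case 3
    moreover have "braid_eq (n + m - 1) (letters True ([a..<a + m]) @ [(c + m - 1, True)])
        ((c + m - 1, True) # letters True ([a..<a + m]))"
      by (rule far_letters) (use far in auto)
    ultimately show ?thesis using far by auto
  next
    case 4
    then show ?thesis using far assms *[of a "c + m - 1"] by auto
  next
    case 5
    moreover have "braid_eq (n + m - 1) (letters True (rev [c..<c + m]) @ [(a, True)])
        ((a, True) # letters True (rev [c..<c + m]))"
      by (rule far_letters) (use far in auto)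
    ultimately show ?thesis using far by (auto intro: braid_eq.sym)
  next
    case 6
    moreover have "braid_eq (n + m - 1) (letters True ([c..<c + m]) @ [(a, True)])
        ((a, True) # letters True ([c..<c + m]))"
      by (rule far_letters) (use far in auto)
    ultimately show ?thesis using far by (auto intro: braid_eq.sym)
  next
    case 7
    then show ?thesis using far assms *[of a c] by auto
  qed
next
  case (braid j)
  have *: "braid_eq (n + m - 1) [(k, True), (Suc k, True), (k, True)] [(Suc k, True), (k, True), (Suc k, True)]"
    if "1 \<le> k" "k + 1 < n + m - 1" for k
    using braid_eq.step[OF braid_relator.braid[OF that], of "[]" "[]"] by simp
  consider "i < j" | "i = j" | "i = Suc j" | "i = Suc (Suc j)" | "Suc (Suc j) < i" by linarith
  then show ?thesis
  proof cases
    case 1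
    then have "Suc (j + m - 1) = j + m" by simp
    with 1 show ?thesis using braid assms *[of "j + m - 1"] by auto
  next
    case 2
    then show ?thesis
      using braid block_slide_down[of j m "n + m - 1"] by (auto simp del: upt_Suc)
  next
    case 3
    then show ?thesis
      using braid block_slide_mid[of j m "n + m - 1"] by (auto simp del: upt_Suc)
  next
    case 4
    then show ?thesis
      using braid block_slide_up[of j m "n + m - 1"] by (auto simp del: upt_Suc)
  next
    case 5
    then show ?thesis using braid assms *[of j] by auto
  qed
qed

lemma braid_eq_cable:
  assumes "braid_eq n w v" "1 \<le> i" "i \<le> n"
  shows "braid_eq (n + m - 1) (word_cable w i m) (word_cable v i m)"
  using assms
proof (induction arbitrary: i rule: braid_eq.induct)
  case (step l r u v)
  let ?p = "word_perm u i"
  have p: "1 \<le> ?p" "?p \<le> n" using word_perm_range[OF step(2) step.prems] by auto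
  have "word_perm l ?p = word_perm r ?p"
    using word_perm_eq[OF braid_eq.step[OF step(1), of "[]" "[]"]] by simp
  moreover have "1 \<le> word_perm l ?p" "word_perm l ?p \<le> n"
    using word_perm_range[of n l ?p] braid_relator_word[OF step(1)] p by auto
  ultimately show ?case
    using step p
    by (auto simp: word_cable_append intro!: braid_eq_context word_cable_relator word_cable_word
        simp del: One_nat_def)
qed (auto intro: braid_eq.intros word_cable_word simp del: One_nat_def)

lift_definition braid_cable :: "braid \<Rightarrow> nat \<Rightarrow> nat \<Rightarrow> braid"
  is "\<lambda>(n, w) i m. if 1 \<le> i \<and> i \<le> n then (n + m - 1, word_cable w i m) else (n, w)"
  by (auto simp: braid_rel_def intro: braid_eq_cable[simplified])


lemma strands_simps [simp]:
  "strands (braid_one n) = n"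
  "strands (braid_gen n j b) = n"
  "strands (s \<odot> s') = strands s"
  "strands (s \<otimes>\<^sub>b s') = strands s + strands s'"
  "1 \<le> i \<Longrightarrow> i \<le> strands s \<Longrightarrow> strands (braid_cable s i m) = strands s + m - 1"
  by (transfer; auto)+


section \<open>Terms\<close>

text \<open>Terms up to renaming of bound variables are given by de Bruijn indices. Free variables are
  indices too, and a context is a list of distinct indices.\<close>

datatype trm = Var nat | Lam trm | App trm trm | Br braid trm

text \<open>The list \<open>x\<^bsub>s(1)\<^esub>, \<dots>, x\<^bsub>s(n)\<^esub>\<close>; list positions start at \<open>0\<close>.\<close>

definition braid_act :: "braid \<Rightarrow> 'a list \<Rightarrow> 'a list" where
  "braid_act s xs = map (\<lambda>i. xs ! (braid_perm s i - 1)) [1..<Suc (length xs)]"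

inductive wf_trm :: "nat list \<Rightarrow> trm \<Rightarrow> bool" (infix "\<turnstile>" 50) where
  Var: "[x] \<turnstile> Var x"
| Lam: "map Suc \<Gamma> @ [0] \<turnstile> M \<Longrightarrow> \<Gamma> \<turnstile> Lam M"
| App: "\<Gamma> \<turnstile> M \<Longrightarrow> \<Gamma>' \<turnstile> N \<Longrightarrow> set \<Gamma> \<inter> set \<Gamma>' = {} \<Longrightarrow> \<Gamma> @ \<Gamma>' \<turnstile> App M N"
| Br: "\<Gamma> \<turnstile> M \<Longrightarrow> strands s = length \<Gamma> \<Longrightarrow> braid_act s \<Gamma> \<turnstile> Br s M"

text \<open>The context of a term is determined by the term.\<close>

primrec ctx :: "trm \<Rightarrow> nat list" where
  "ctx (Var x) = [x]"
| "ctx (Lam M) = map (\<lambda>x. x - 1) (filter (\<lambda>x. x \<noteq> 0) (ctx M))"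
| "ctx (App M N) = ctx M @ ctx N"
| "ctx (Br s M) = braid_act s (ctx M)"

lemma ctx_eq: "\<Gamma> \<turnstile> M \<Longrightarrow> ctx M = \<Gamma>"
  by (induction rule: wf_trm.induct) (auto simp: filter_map comp_def)

text \<open>Capture-avoiding substitution for de Bruijn indices: the indices above the replaced variable
  are decremented.\<close>

primrec lift_trm :: "nat \<Rightarrow> trm \<Rightarrow> trm" where
  "lift_trm k (Var x) = Var (if x < k then x else Suc x)"
| "lift_trm k (Lam M) = Lam (lift_trm (Suc k) M)"
| "lift_trm k (App M N) = App (lift_trm k M) (lift_trm k N)"
| "lift_trm k (Br s M) = Br s (lift_trm k M)"

definition position :: "'a \<Rightarrow> 'a list \<Rightarrow> nat" where
  "position x xs = (LEAST i. 1 \<le> i \<and> i \<le> length xs \<and> xs ! (i - 1) = x)"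

primrec subst :: "trm \<Rightarrow> nat \<Rightarrow> trm \<Rightarrow> trm" where
  "subst (Var y) x N = (if y = x then N else if x < y then Var (y - 1) else Var y)"
| "subst (Lam M) x N = Lam (subst M (Suc x) (lift_trm 0 N))"
| "subst (App M M') x N = App (subst M x N) (subst M' x N)"
| "subst (Br s M) x N =
    (if x \<in> set (ctx M)
     then Br (braid_cable s (inv (braid_perm s) (position x (ctx M))) (length (ctx N))) (subst M x N)
     else Br s (subst M x N))"


section \<open>Equality\<close>

text \<open>The equality is stated per context. Every rule keeps the context, so this is the congruence on
  terms; that both sides are terms in \<open>\<Gamma>\<close> is \<open>beta_eta_wf\<close> below.\<close>

inductive beta_eta :: "nat list \<Rightarrow> trm \<Rightarrow> trm \<Rightarrow> bool"
  ("_ \<turnstile> _ =\<^sub>\<beta>\<^sub>\<eta> _" [51, 51, 51] 50) where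
  refl: "\<Gamma> \<turnstile> M \<Longrightarrow> \<Gamma> \<turnstile> M =\<^sub>\<beta>\<^sub>\<eta> M"
| sym: "\<Gamma> \<turnstile> M =\<^sub>\<beta>\<^sub>\<eta> N \<Longrightarrow> \<Gamma> \<turnstile> N =\<^sub>\<beta>\<^sub>\<eta> M"
| trans: "\<Gamma> \<turnstile> M =\<^sub>\<beta>\<^sub>\<eta> N \<Longrightarrow> \<Gamma> \<turnstile> N =\<^sub>\<beta>\<^sub>\<eta> P \<Longrightarrow> \<Gamma> \<turnstile> M =\<^sub>\<beta>\<^sub>\<eta> P"
| Lam: "map Suc \<Gamma> @ [0] \<turnstile> M =\<^sub>\<beta>\<^sub>\<eta> N \<Longrightarrow> \<Gamma> \<turnstile> Lam M =\<^sub>\<beta>\<^sub>\<eta> Lam N"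
| App: "\<Gamma> \<turnstile> M =\<^sub>\<beta>\<^sub>\<eta> M' \<Longrightarrow> \<Gamma>' \<turnstile> N =\<^sub>\<beta>\<^sub>\<eta> N' \<Longrightarrow> set \<Gamma> \<inter> set \<Gamma>' = {} \<Longrightarrow>
    \<Gamma> @ \<Gamma>' \<turnstile> App M N =\<^sub>\<beta>\<^sub>\<eta> App M' N'"
| Br: "\<Gamma> \<turnstile> M =\<^sub>\<beta>\<^sub>\<eta> N \<Longrightarrow> strands s = length \<Gamma> \<Longrightarrow> braid_act s \<Gamma> \<turnstile> Br s M =\<^sub>\<beta>\<^sub>\<eta> Br s N"
| beta: "\<Gamma> \<turnstile> App (Lam M) N \<Longrightarrow> \<Gamma> \<turnstile> App (Lam M) N =\<^sub>\<beta>\<^sub>\<eta> subst M 0 N"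
| eta: "\<Gamma> \<turnstile> M \<Longrightarrow> \<Gamma> \<turnstile> Lam (App (lift_trm 0 M) (Var 0)) =\<^sub>\<beta>\<^sub>\<eta> M"
| Br_one: "\<Gamma> \<turnstile> M \<Longrightarrow> \<Gamma> \<turnstile> Br (braid_one (length \<Gamma>)) M =\<^sub>\<beta>\<^sub>\<eta> M"
| Br_mult: "\<Gamma> \<turnstile> Br s (Br s' M) \<Longrightarrow> \<Gamma> \<turnstile> Br s (Br s' M) =\<^sub>\<beta>\<^sub>\<eta> Br (s \<odot> s') M"
| Br_App: "\<Gamma> \<turnstile> App (Br s M) (Br s' N) \<Longrightarrow>
    \<Gamma> \<turnstile> App (Br s M) (Br s' N) =\<^sub>\<beta>\<^sub>\<eta> Br (s \<otimes>\<^sub>b s') (App M N)"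
| Br_Lam: "\<Gamma> \<turnstile> Br s (Lam M) \<Longrightarrow> \<Gamma> \<turnstile> Br s (Lam M) =\<^sub>\<beta>\<^sub>\<eta> Lam (Br (s \<otimes>\<^sub>b braid_one 1) M)"


section \<open>Combinators\<close>

definition comb_I :: trm where
  "comb_I = Lam (Var 0)"

definition comb_B :: trm where
  "comb_B = Lam (Lam (Lam (App (Var 2) (App (Var 1) (Var 0)))))"

definition comb_C_plus :: trm where
  "comb_C_plus =
    Lam (Lam (Lam (Br (braid_one 1 \<otimes>\<^sub>b braid_gen 2 1 True) (App (App (Var 2) (Var 0)) (Var 1)))))"

definition comb_C_minus :: trm where
  "comb_C_minus =
    Lam (Lam (Lam (Br (braid_one 1 \<otimes>\<^sub>b braid_gen 2 1 False) (App (App (Var 2) (Var 0)) (Var 1)))))"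

inductive combinatory :: "trm \<Rightarrow> bool" where
  B: "combinatory comb_B"
| I: "combinatory comb_I"
| C_plus: "combinatory comb_C_plus"
| C_minus: "combinatory comb_C_minus"
| App: "combinatory M \<Longrightarrow> combinatory N \<Longrightarrow> combinatory (App M N)"


section \<open>Both sides of an equation are terms in the given context\<close>

lemma word_perm_block_down:
  "word_perm (letters b (rev [j..<j + m])) p =
    (if j \<le> p \<and> p < j + m then Suc p else if p = j + m then j else p)"
  by (induction m arbitrary: p) (auto simp: transpose_def)

lemma word_perm_block_up:
  "word_perm (letters b [j..<j + m]) p =
    (if j < p \<and> p \<le> j + m then p - 1 else if p = j then j + m else p)"
  by (induction m arbitrary: p) (auto simp: transpose_def)

definition spread :: "nat \<Rightarrow> nat \<Rightarrow> nat \<Rightarrow> nat" where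
  "spread i m p = (if p < i then p else p + m - 1)"

lemma word_perm_cable_other:
  "braid_word n w \<Longrightarrow> 1 \<le> i \<Longrightarrow> 1 \<le> p \<Longrightarrow> p \<noteq> i \<Longrightarrow>
    word_perm (word_cable w i m) (spread i m p) = spread (word_perm w i) m (word_perm w p)"
proof (induction w i m arbitrary: p rule: word_cable.induct)
  case (1 i m)
  then show ?case by simp
next
  case (2 j b w i m)
  note prems = "2.prems" and IH = "2.IH"
  have j: "1 \<le> j" "braid_word n w" using prems by auto
  let ?q = "transpose j (Suc j) p" and ?i = "transpose j (Suc j) i"
  have q: "1 \<le> ?q" "?q \<noteq> ?i" using prems j by (auto simp: transpose_def)
  consider "i < j" | "i = j" | "i = Suc j" | "Suc j < i" by linarith
  then show ?case
  proof cases
    case 1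
    then have "transpose (j + m - 1) (Suc (j + m - 1)) (spread i m p) = spread i m ?q"
      using prems by (auto simp: transpose_def spread_def)
    then show ?thesis using 1 IH(1)[OF 1 j(2) prems(2) q(1)] q by auto
  next
    case 2
    then have "word_perm (letters b (rev [j..<j + m])) (spread i m p) = spread (Suc j) m ?q"
      using prems unfolding word_perm_block_down by (auto simp: transpose_def spread_def)
    then show ?thesis using 2 IH(3)[of ?q] q j by (auto simp del: upt_Suc)
  next
    case 3
    then have "word_perm (letters b [j..<j + m]) (spread i m p) = spread j m ?q"
      using prems unfolding word_perm_block_up by (auto simp: transpose_def spread_def)
    then show ?thesis using 3 IH(4)[of ?q] q j by (auto simp del: upt_Suc)
  next
    case 4
    then have "transpose j (Suc j) (spread i m p) = spread i m ?q"
      using prems by (auto simp: transpose_def spread_def)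
    then show ?thesis using 4 IH(2)[of ?q] q j prems by auto
  qed
qed

lemma word_perm_cable_block:
  "k < m \<Longrightarrow> word_perm (word_cable w i m) (i + k) = word_perm w i + k"
proof (induction w i m rule: word_cable.induct)
  case (1 i m)
  then show ?case by simp
next
  case (2 j b w i m)
  consider "i < j" | "i = j" | "i = Suc j" | "Suc j < i" by linarith
  then show ?case
  proof cases
    case 1
    with 2 show ?thesis by (auto simp: transpose_def)
  next
    case a: 2
    have "word_perm (letters b (rev [j..<j + m])) (j + k) = Suc j + k"
      using 2 unfolding word_perm_block_down by auto
    with 2 a show ?thesis by auto
  next
    case 3
    have "word_perm (letters b [j..<j + m]) (Suc j + k) = j + k"
      using 2 unfolding word_perm_block_up by auto
    with 2 3 show ?thesis by auto
  next
    case 4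
    with 2 show ?thesis by (auto simp: transpose_def)
  qed
qed

lemma braid_perm_range:
  "1 \<le> i \<Longrightarrow> i \<le> strands s \<Longrightarrow> 1 \<le> braid_perm s i \<and> braid_perm s i \<le> strands s"
  by transfer (use word_perm_range braid_eq_word in \<open>fastforce simp: braid_rel_def\<close>)

lemma braid_cases:
  obtains n w where "braid_word n w" "s = abs_braid (n, w)" "strands s = n" "braid_perm s = word_perm w"
    "\<And>i m. 1 \<le> i \<Longrightarrow> i \<le> n \<Longrightarrow> braid_perm (braid_cable s i m) = word_perm (word_cable w i m)"
proof -
  obtain n w where nw: "rep_braid s = (n, w)" by force
  have r: "braid_rel (n, w) (n, w)" using Quotient_rep_reflp[OF Quotient_braid, of s] nw by simp
  have s: "s = abs_braid (n, w)" using Quotient_abs_rep[OF Quotient_braid, of s] nw by simp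
  have e: "braid_eq n w w" using r by (simp add: braid_rel_def)
  have "braid_word n w" using e braid_eq_word by blast
  moreover have "strands s = n" using r by (simp add: s strands.abs_eq)
  moreover have "braid_perm s = word_perm w" using r by (simp add: s braid_perm.abs_eq)
  moreover have "braid_perm (braid_cable s i m) = word_perm (word_cable w i m)" if "1 \<le> i" "i \<le> n" for i m
  proof -
    have r2: "braid_rel (n + m - 1, word_cable w i m) (n + m - 1, word_cable w i m)"
      using braid_eq_cable[OF e that] by (simp add: braid_rel_def)
    have "braid_cable s i m = abs_braid (n + m - 1, word_cable w i m)"
      using that r by (simp add: s braid_cable.abs_eq)
    then show ?thesis using r2 braid_perm.abs_eq[OF r2[unfolded eq_onp_def]] by simp
  qed
  ultimately show ?thesis using s that by blast
qed

lemma braid_perm_cable_other: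
  "1 \<le> i \<Longrightarrow> i \<le> strands s \<Longrightarrow> 1 \<le> p \<Longrightarrow> p \<noteq> i \<Longrightarrow>
    braid_perm (braid_cable s i m) (spread i m p) = spread (braid_perm s i) m (braid_perm s p)"
  by (rule braid_cases[of s]) (simp add: word_perm_cable_other del: One_nat_def)

lemma braid_perm_cable_block:
  "1 \<le> i \<Longrightarrow> i \<le> strands s \<Longrightarrow> k < m \<Longrightarrow>
    braid_perm (braid_cable s i m) (i + k) = braid_perm s i + k"
  by transfer (auto simp: braid_rel_def word_perm_cable_block)

lemma word_perm_outside: "braid_word n w \<Longrightarrow> n < i \<or> i = 0 \<Longrightarrow> word_perm w i = i"
  by (induction w i rule: word_perm.induct) (auto simp: transpose_def)

lemma word_perm_shift: "0 < i \<Longrightarrow> braid_word n w \<Longrightarrow> word_perm (shift_word k w) (k + i) = k + word_perm w i"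
proof (induction w i rule: word_perm.induct)
  case (2 j b w i)
  show ?case
  proof (cases "j = 0")
    case False
    then have "transpose (k + j) (Suc (k + j)) (k + i) = k + transpose j (Suc j) i" "0 < transpose j (Suc j) i"
      using 2 by (auto simp: transpose_def)
    then show ?thesis using 2 by (simp add: shift_word_def)
  next
    case True
    then show ?thesis using 2 by simp
  qed
qed (simp add: shift_word_def)

lemma word_perm_shift_low: "i \<le> k \<Longrightarrow> braid_word n w \<Longrightarrow> word_perm (shift_word k w) i = i"
proof (induction w)
  case (Cons g w)
  obtain j b where g: "g = (j, b)" by force
  then show ?case using Cons by (auto simp: transpose_def shift_word_def)
qed (simp add: shift_word_def)

lemma braid_perm_simps:
  "braid_perm (braid_one n) i = i"
  "braid_perm (braid_gen n j b) i = (if 1 \<le> j \<and> j < n then transpose j (Suc j) i else i)"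
  "strands s = strands s' \<Longrightarrow> braid_perm (s \<odot> s') i = braid_perm s' (braid_perm s i)"
  by (transfer; auto)+

lemma word_perm_tensor:
  assumes "braid_word m v"
  shows "word_perm (shift_word n v) j = (if j \<le> n then j else n + word_perm v (j - n))"
  using word_perm_shift_low[OF _ assms, of j n] word_perm_shift[OF _ assms, of "j - n" n] by auto

lemma braid_perm_tensor:
  "braid_perm (s \<otimes>\<^sub>b s') i =
     (if braid_perm s i \<le> strands s then braid_perm s i
      else strands s + braid_perm s' (braid_perm s i - strands s))"
  by transfer (clarsimp simp: braid_rel_def, metis word_perm_tensor braid_eq_word)

lemma braid_perm_outside: "strands s < i \<Longrightarrow> braid_perm s i = i"
  by (rule braid_cases[of s]) (simp add: word_perm_outside)

lemma braid_perm_tensor_left: "1 \<le> i \<Longrightarrow> i \<le> strands s \<Longrightarrow> braid_perm (s \<otimes>\<^sub>b s') i = braid_perm s i"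
  using braid_perm_range[of i s] by (simp add: braid_perm_tensor)

lemma braid_perm_tensor_right:
  "1 \<le> i \<Longrightarrow> braid_perm (s \<otimes>\<^sub>b s') (strands s + i) = strands s + braid_perm s' i"
  by (simp add: braid_perm_tensor braid_perm_outside)

lemma length_braid_act [simp]: "length (braid_act s xs) = length xs"
  by (simp add: braid_act_def del: upt_Suc)

lemma braid_act_nth: "k < length xs \<Longrightarrow> braid_act s xs ! k = xs ! (braid_perm s (Suc k) - 1)"
  by (simp add: braid_act_def del: upt_Suc add: nth_upt)

lemma braid_perm_inject: "braid_perm s a = braid_perm s b \<longleftrightarrow> a = b"
  using bij_braid_perm[of s] by (metis bij_def inj_eq)

lemma inv_braid_perm_range:
  assumes "1 \<le> i" "i \<le> strands s"
  shows "1 \<le> inv (braid_perm s) i \<and> inv (braid_perm s) i \<le> strands s"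
proof -
  have inj: "inj_on (braid_perm s) {1..strands s}" by (auto simp: inj_on_def braid_perm_inject)
  have "braid_perm s ` {1..strands s} \<subseteq> {1..strands s}" using braid_perm_range by fastforce
  then have "braid_perm s ` {1..strands s} = {1..strands s}"
    using inj by (intro endo_inj_surj) auto
  then obtain p where "p \<in> {1..strands s}" "braid_perm s p = i" using assms by (metis atLeastAtMost_iff imageE)
  then show ?thesis using inv_f_f[of "braid_perm s" p] bij_braid_perm[of s] by (auto simp: bij_def)
qed

lemma braid_perm_inv: "braid_perm s (inv (braid_perm s) i) = i"
  using bij_braid_perm[of s] by (simp add: bij_is_surj surj_f_inv_f)

lemma set_braid_act: assumes "strands s = length xs" shows "set (braid_act s xs) = set xs"
proof
  show "set (braid_act s xs) \<subseteq> set xs"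
  proof
    fix x assume "x \<in> set (braid_act s xs)"
    then obtain k where k: "k < length xs" "x = xs ! (braid_perm s (Suc k) - 1)"
      by (auto simp: in_set_conv_nth braid_act_nth)
    then show "x \<in> set xs" using braid_perm_range[of "Suc k" s] assms by (auto intro!: nth_mem)
  qed
  show "set xs \<subseteq> set (braid_act s xs)"
  proof
    fix x assume "x \<in> set xs"
    then obtain k where k: "k < length xs" "x = xs ! k" by (auto simp: in_set_conv_nth)
    let ?p = "inv (braid_perm s) (Suc k)"
    have p: "1 \<le> ?p" "?p \<le> length xs" using inv_braid_perm_range[of "Suc k" s] k assms by auto
    then have "braid_act s xs ! (?p - 1) = x" using k by (subst braid_act_nth) (auto simp: braid_perm_inv)
    then show "x \<in> set (braid_act s xs)" using p nth_mem[of "?p - 1" "braid_act s xs"] by simp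
  qed
qed

lemma distinct_braid_act: assumes "strands s = length xs" "distinct xs" shows "distinct (braid_act s xs)"
  using set_braid_act[OF assms(1)] distinct_card[OF assms(2)] card_distinct[of "braid_act s xs"] by simp

lemma wf_distinct: "\<Gamma> \<turnstile> M \<Longrightarrow> distinct \<Gamma>"
  by (induction rule: wf_trm.induct) (auto simp: distinct_braid_act distinct_map)

lemma braid_act_map: assumes "strands s = length xs" shows "braid_act s (map f xs) = map f (braid_act s xs)"
proof (rule nth_equalityI)
  fix k assume "k < length (braid_act s (map f xs))"
  then show "braid_act s (map f xs) ! k = map f (braid_act s xs) ! k"
    using braid_perm_range[of "Suc k" s] assms by (auto simp: braid_act_nth)
qed simp

definition lift_var :: "nat \<Rightarrow> nat \<Rightarrow> nat" where "lift_var k x = (if x < k then x else Suc (x::nat))"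
definition lower_var :: "nat \<Rightarrow> nat \<Rightarrow> nat" where "lower_var x y = (if x < y then y - 1 else (y::nat))"
definition subst_ctx :: "nat list \<Rightarrow> nat \<Rightarrow> nat list \<Rightarrow> nat list" where "subst_ctx \<Gamma> x \<Delta> = concat (map (\<lambda>y. if y = x then \<Delta> else [lower_var x y]) \<Gamma>)"

lemma lift_wf: "\<Gamma> \<turnstile> M \<Longrightarrow> map (lift_var k) \<Gamma> \<turnstile> lift_trm k M"
proof (induction arbitrary: k rule: wf_trm.induct)
  case (Var x)
  then show ?case using wf_trm.Var by (auto simp: lift_var_def)
next
  case (Lam \<Gamma> M)
  have "map (lift_var (Suc k)) (map Suc \<Gamma> @ [0]) = map Suc (map (lift_var k) \<Gamma>) @ [0]" by (auto simp: lift_var_def)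
  with Lam.IH[of "Suc k"] show ?case by (metis wf_trm.Lam lift_trm.simps(2))
next
  case (App \<Gamma> M \<Gamma>' N)
  have "inj (lift_var k)" by (auto simp: inj_def lift_var_def split: if_splits)
  then have "set (map (lift_var k) \<Gamma>) \<inter> set (map (lift_var k) \<Gamma>') = {}" using App(3) by (auto simp: inj_eq)
  from wf_trm.App[OF App.IH(1)[of k] App.IH(2)[of k] this] show ?case by simp
next
  case (Br \<Gamma> M s)
  from wf_trm.Br[OF Br.IH[of k], of s] Br show ?case by (simp add: braid_act_map)
qed

lemma subst_ctx_notin: "x \<notin> set \<Gamma> \<Longrightarrow> subst_ctx \<Gamma> x \<Delta> = map (lower_var x) \<Gamma>"
  by (induction \<Gamma>) (auto simp: subst_ctx_def)

lemma subst_ctx_append: "subst_ctx (A @ B) x \<Delta> = subst_ctx A x \<Delta> @ subst_ctx B x \<Delta>"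
  by (simp add: subst_ctx_def)

lemma subst_ctx_in: "x \<notin> set A \<Longrightarrow> x \<notin> set B \<Longrightarrow> subst_ctx (A @ x # B) x \<Delta> = map (lower_var x) A @ \<Delta> @ map (lower_var x) B"
  using subst_ctx_append[of A "x # B" x \<Delta>] subst_ctx_notin[of x A \<Delta>] subst_ctx_notin[of x B \<Delta>] by (simp add: subst_ctx_def)

lemma set_subst_ctx: "set (subst_ctx \<Gamma> x \<Delta>) \<subseteq> lower_var x ` (set \<Gamma> - {x}) \<union> (if x \<in> set \<Gamma> then set \<Delta> else {})"
  by (auto simp: subst_ctx_def split: if_splits)

lemma position_split: assumes "x \<notin> set A" shows "position x (A @ x # B) = Suc (length A)"
  unfolding position_def
proof (rule Least_equality)
  fix y assume y: "1 \<le> y \<and> y \<le> length (A @ x # B) \<and> (A @ x # B) ! (y - 1) = x"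
  show "Suc (length A) \<le> y"
  proof (rule ccontr)
    assume "\<not> ?thesis"
    then have "y - 1 < length A" using y by auto
    then have "A ! (y - 1) = x" using y by (simp add: nth_append)
    with \<open>y - 1 < length A\<close> assms show False by (metis nth_mem)
  qed
qed simp

lemma spread_nth:
  assumes "1 \<le> r" "r \<le> Suc (length A + length B)" "r \<noteq> Suc (length A)"
  shows "(map f A @ D @ map f B) ! (spread (Suc (length A)) (length D) r - 1) = f ((A @ x # B) ! (r - 1))"
  using assms by (auto simp: spread_def nth_append nth_Cons' not_less)

lemma braid_act_subst_ctx:
  assumes "distinct \<Gamma>" "x \<in> set \<Gamma>" "strands s = length \<Gamma>"
  shows "braid_act (braid_cable s (inv (braid_perm s) (position x \<Gamma>)) (length \<Delta>)) (subst_ctx \<Gamma> x \<Delta>)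
    = subst_ctx (braid_act s \<Gamma>) x \<Delta>"
proof -
  obtain A B where AB: "\<Gamma> = A @ x # B" "x \<notin> set A" "x \<notin> set B"
    using assms(1,2) by (auto dest!: split_list)
  let ?i = "Suc (length A)" and ?m = "length \<Delta>"
  define p where "p = inv (braid_perm s) ?i"
  have p: "1 \<le> p" "p \<le> length \<Gamma>" using inv_braid_perm_range[of ?i s] assms AB by (auto simp: p_def)
  have pp: "braid_perm s p = ?i" by (simp add: p_def braid_perm_inv)
  have pos: "position x \<Gamma> = ?i" unfolding AB(1) by (rule position_split[OF AB(2)])
  define C where "C = take (p - 1) (braid_act s \<Gamma>)"
  define E where "E = drop p (braid_act s \<Gamma>)"
  have "braid_act s \<Gamma> ! (p - 1) = x" using p pp AB by (subst braid_act_nth) auto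
  then have CE: "braid_act s \<Gamma> = C @ x # E"
    using p id_take_nth_drop[of "p - 1" "braid_act s \<Gamma>"] by (simp add: C_def E_def)
  have lC: "length C = p - 1" using p by (simp add: C_def)
  have lE: "length E = length \<Gamma> - p" using p by (simp add: E_def)
  have "distinct (C @ x # E)" using CE distinct_braid_act[of s \<Gamma>] assms by metis
  then have x: "x \<notin> set C" "x \<notin> set E" by auto
  have S1: "subst_ctx \<Gamma> x \<Delta> = map (lower_var x) A @ \<Delta> @ map (lower_var x) B" using AB subst_ctx_in by simp
  have S2: "subst_ctx (braid_act s \<Gamma>) x \<Delta> = map (lower_var x) C @ \<Delta> @ map (lower_var x) E" using CE subst_ctx_in x by simp
  have len: "length (subst_ctx \<Gamma> x \<Delta>) = length (subst_ctx (braid_act s \<Gamma>) x \<Delta>)"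
    using p unfolding S1 S2 by (simp add: lC lE AB(1))
  have "braid_act (braid_cable s p ?m) (subst_ctx \<Gamma> x \<Delta>) = subst_ctx (braid_act s \<Gamma>) x \<Delta>"
  proof (rule nth_equalityI)
    fix k assume "k < length (braid_act (braid_cable s p ?m) (subst_ctx \<Gamma> x \<Delta>))"
    then have k: "k < length (subst_ctx \<Gamma> x \<Delta>)" by simp
    show "braid_act (braid_cable s p ?m) (subst_ctx \<Gamma> x \<Delta>) ! k = subst_ctx (braid_act s \<Gamma>) x \<Delta> ! k"
    proof (cases "Suc k \<ge> p \<and> Suc k < p + ?m")
      case True
      then obtain q where q: "Suc k = p + q" "q < ?m"
        by (metis le_Suc_ex nat_add_left_cancel_less)
      have "braid_perm (braid_cable s p ?m) (p + q) = ?i + q"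
        using braid_perm_cable_block[of p s q ?m] p assms q pp by simp
      then have "braid_act (braid_cable s p ?m) (subst_ctx \<Gamma> x \<Delta>) ! k = \<Delta> ! q"
        using k q by (simp add: braid_act_nth S1 nth_append)
      moreover have "k = length C + q" using q p lC by simp
      ultimately show ?thesis using q by (simp add: S2 nth_append)
    next
      case False
      define r where "r = (if Suc k < p then Suc k else Suc (Suc k) - ?m)"
      have r: "1 \<le> r" "r \<le> length \<Gamma>" "r \<noteq> p" "spread p ?m r = Suc k"
        using False k[unfolded S1] p AB(1) by (auto simp: r_def spread_def)
      let ?r = "braid_perm s r"
      have rr: "1 \<le> ?r" "?r \<le> length \<Gamma>" "?r \<noteq> ?i"
        using braid_perm_range[of r s] r assms braid_perm_inject[of s r p] pp by auto
      have "braid_act (braid_cable s p ?m) (subst_ctx \<Gamma> x \<Delta>) ! k = subst_ctx \<Gamma> x \<Delta> ! (spread ?i ?m ?r - 1)"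
        using k braid_perm_cable_other[of p s r ?m] p r pp assms by (simp add: braid_act_nth)
      also have "\<dots> = lower_var x (\<Gamma> ! (?r - 1))"
        using spread_nth[of ?r A B "lower_var x" \<Delta> x] rr unfolding S1 unfolding AB(1) by simp
      also have "\<Gamma> ! (?r - 1) = braid_act s \<Gamma> ! (r - 1)" using r by (subst braid_act_nth) auto
      also have "lower_var x (braid_act s \<Gamma> ! (r - 1)) = subst_ctx (braid_act s \<Gamma>) x \<Delta> ! (spread p ?m r - 1)"
        using spread_nth[of r C E "lower_var x" \<Delta> x] r p lC lE unfolding S2 unfolding CE by (simp; fastforce)
      finally show ?thesis using r by simp
    qed
  qed (simp add: len)
  then show ?thesis by (simp add: pos p_def)
qed

lemma subst_wf:
  assumes "\<Gamma> \<turnstile> M" "\<Delta> \<turnstile> N" "set \<Delta> \<inter> lower_var x ` (set \<Gamma> - {x}) = {}"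
  shows "subst_ctx \<Gamma> x \<Delta> \<turnstile> subst M x N"
  using assms
proof (induction arbitrary: x \<Delta> N rule: wf_trm.induct)
  case (Var y)
  then show ?case using wf_trm.Var by (auto simp: subst_ctx_def lower_var_def)
next
  case (Lam \<Gamma> M)
  have lift_var: "lift_var 0 = Suc" by (auto simp: lift_var_def)
  have e: "subst_ctx (map Suc \<Gamma> @ [0]) (Suc x) (map Suc \<Delta>) = map Suc (subst_ctx \<Gamma> x \<Delta>) @ [0]"
  proof -
    have "subst_ctx (map Suc \<Gamma>) (Suc x) (map Suc \<Delta>) = map Suc (subst_ctx \<Gamma> x \<Delta>)"
      by (induction \<Gamma>) (auto simp: subst_ctx_def lower_var_def)
    moreover have "subst_ctx [0] (Suc x) (map Suc \<Delta>) = [0]" by (simp add: subst_ctx_def lower_var_def)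
    ultimately show ?thesis by (simp add: subst_ctx_append)
  qed
  have "set (map Suc \<Delta>) \<inter> lower_var (Suc x) ` (set (map Suc \<Gamma> @ [0]) - {Suc x}) = {}"
  proof -
    have "lower_var (Suc x) (Suc y) = Suc (lower_var x y)" if "y \<noteq> x" for y using that by (auto simp: lower_var_def)
    then have "lower_var (Suc x) ` (set (map Suc \<Gamma> @ [0]) - {Suc x}) \<subseteq> insert 0 (Suc ` lower_var x ` (set \<Gamma> - {x}))"
      by (auto simp: lower_var_def[of _ 0])
    then show ?thesis using Lam.prems(2) by auto
  qed
  from Lam.IH[OF lift_wf[OF Lam.prems(1), of 0, unfolded lift_var] this]
  show ?case by (auto simp: e intro: wf_trm.Lam)
next
  case (App \<Gamma> M \<Gamma>' M')
  have inj: "lower_var x y = lower_var x z \<longleftrightarrow> y = z" if "y \<noteq> x" "z \<noteq> x" for y z using that by (auto simp: lower_var_def)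
  have 1: "subst_ctx \<Gamma> x \<Delta> \<turnstile> subst M x N" "subst_ctx \<Gamma>' x \<Delta> \<turnstile> subst M' x N"
    using App.prems by (auto intro!: App.IH)
  have "set (subst_ctx \<Gamma> x \<Delta>) \<inter> set (subst_ctx \<Gamma>' x \<Delta>) = {}"
  proof -
    have d: "lower_var x ` (set \<Gamma> - {x}) \<inter> lower_var x ` (set \<Gamma>' - {x}) = {}" using App(3) inj by fastforce
    have d2: "set \<Delta> \<inter> lower_var x ` (set \<Gamma> - {x}) = {}" "set \<Delta> \<inter> lower_var x ` (set \<Gamma>' - {x}) = {}" using App.prems by auto
    show ?thesis
    proof (cases "x \<in> set \<Gamma>")
      case True
      then have "x \<notin> set \<Gamma>'" using App(3) by auto
      then show ?thesis using set_subst_ctx[of \<Gamma> x \<Delta>] set_subst_ctx[of \<Gamma>' x \<Delta>] d d2 True by (simp) blast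
    next
      case False
      then have "set (subst_ctx \<Gamma> x \<Delta>) \<subseteq> lower_var x ` (set \<Gamma> - {x})" using set_subst_ctx[of \<Gamma> x \<Delta>] by simp
      moreover have "set (subst_ctx \<Gamma>' x \<Delta>) \<subseteq> lower_var x ` (set \<Gamma>' - {x}) \<union> set \<Delta>"
        using set_subst_ctx[of \<Gamma>' x \<Delta>] by (rule order_trans) auto
      ultimately show ?thesis using d d2 by blast
    qed
  qed
  with 1 show ?case by (auto simp: subst_ctx_append intro: wf_trm.App)
next
  case (Br \<Gamma> M s)
  note dist = wf_distinct[OF Br(1)]
  have IH: "subst_ctx \<Gamma> x \<Delta> \<turnstile> subst M x N" using Br.prems Br(2) by (intro Br.IH) (auto simp: set_braid_act)
  have c: "ctx M = \<Gamma>" "ctx N = \<Delta>" using ctx_eq Br by auto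
  show ?case
  proof (cases "x \<in> set \<Gamma>")
    case True
    obtain A B where AB: "\<Gamma> = A @ x # B" "x \<notin> set A" "x \<notin> set B"
      using dist True by (auto dest!: split_list)
    have pos: "position x \<Gamma> = Suc (length A)" unfolding AB(1) by (rule position_split[OF AB(2)])
    have p: "1 \<le> inv (braid_perm s) (position x \<Gamma>)" "inv (braid_perm s) (position x \<Gamma>) \<le> strands s"
      using inv_braid_perm_range[of "position x \<Gamma>" s] Br(2) AB pos by auto
    have st: "strands (braid_cable s (inv (braid_perm s) (position x \<Gamma>)) (length \<Delta>)) = length (subst_ctx \<Gamma> x \<Delta>)"
      using strands_simps(5)[OF p] Br(2) AB by (simp add: subst_ctx_in)
    show ?thesis
      using wf_trm.Br[OF IH st] braid_act_subst_ctx[OF dist True Br(2)] True c by simp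
  next
    case False
    then have "x \<notin> set (braid_act s \<Gamma>)" using set_braid_act Br(2) by blast
    then show ?thesis
      using wf_trm.Br[OF IH, of s] Br(2) False c by (simp add: subst_ctx_notin braid_act_map)
  qed
qed

lemma braid_act_one: "braid_act (braid_one n) xs = xs"
  by (rule nth_equalityI) (auto simp: braid_act_nth braid_perm_simps)

lemma braid_act_mult:
  assumes "strands s = length xs" "strands s' = length xs"
  shows "braid_act (s \<odot> s') xs = braid_act s (braid_act s' xs)"
proof (rule nth_equalityI)
  fix k assume "k < length (braid_act (s \<odot> s') xs)"
  then show "braid_act (s \<odot> s') xs ! k = braid_act s (braid_act s' xs) ! k"
    using braid_perm_range[of "Suc k" s] assms by (auto simp: braid_act_nth braid_perm_simps)
qed simp

lemma braid_act_tensor: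
  assumes "strands s = length xs" "strands s' = length ys"
  shows "braid_act (s \<otimes>\<^sub>b s') (xs @ ys) = braid_act s xs @ braid_act s' ys"
proof (rule nth_equalityI)
  fix k assume "k < length (braid_act (s \<otimes>\<^sub>b s') (xs @ ys))"
  then have k: "k < length xs + length ys" by simp
  show "braid_act (s \<otimes>\<^sub>b s') (xs @ ys) ! k = (braid_act s xs @ braid_act s' ys) ! k"
  proof (cases "k < length xs")
    case True
    then show ?thesis using k braid_perm_range[of "Suc k" s] assms
      by (auto simp: braid_act_nth nth_append braid_perm_tensor_left)
  next
    case False
    then obtain q where q: "k = length xs + q" by (metis le_Suc_ex not_less)
    then have "braid_perm (s \<otimes>\<^sub>b s') (Suc k) = length xs + braid_perm s' (Suc q)"
      using braid_perm_tensor_right[of "Suc q" s s'] assms by simp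
    then show ?thesis using k q braid_perm_range[of "Suc q" s'] assms
      by (auto simp: braid_act_nth nth_append)
  qed
qed simp

inductive_cases wf_LamE: "\<Gamma> \<turnstile> Lam M"
inductive_cases wf_AppE: "\<Gamma> \<turnstile> App M N"
inductive_cases wf_BrE: "\<Gamma> \<turnstile> Br s M"

theorem beta_eta_wf: "\<Gamma> \<turnstile> M =\<^sub>\<beta>\<^sub>\<eta> N \<Longrightarrow> \<Gamma> \<turnstile> M \<and> \<Gamma> \<turnstile> N"
proof (induction rule: beta_eta.induct)
  case (beta \<Gamma> M N)
  then obtain \<Gamma>1 \<Gamma>2 where g: "\<Gamma> = \<Gamma>1 @ \<Gamma>2" "map Suc \<Gamma>1 @ [0] \<turnstile> M" "\<Gamma>2 \<turnstile> N" "set \<Gamma>1 \<inter> set \<Gamma>2 = {}"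
    by (auto elim!: wf_AppE wf_LamE)
  have "subst_ctx (map Suc \<Gamma>1 @ [0]) 0 \<Gamma>2 \<turnstile> subst M 0 N"
    by (rule subst_wf[OF g(2,3)]) (use g(4) in \<open>auto simp: lower_var_def\<close>)
  moreover have "subst_ctx (map Suc \<Gamma>1 @ [0]) 0 \<Gamma>2 = \<Gamma>"
    using subst_ctx_in[of 0 "map Suc \<Gamma>1" "[]" \<Gamma>2] g by (simp add: lower_var_def comp_def)
  ultimately show ?case using beta by simp
next
  case (eta \<Gamma> M)
  have "lift_var 0 = Suc" by (auto simp: lift_var_def)
  with lift_wf[OF eta, of 0] have "map Suc \<Gamma> \<turnstile> lift_trm 0 M" by simp
  from wf_trm.App[OF this wf_trm.Var[of 0]] eta show ?case by (auto intro: wf_trm.Lam)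
next
  case (Br_one \<Gamma> M)
  then show ?case using wf_trm.Br[of \<Gamma> M "braid_one (length \<Gamma>)"] by (simp add: braid_act_one)
next
  case (Br_mult \<Gamma> s s' M)
  then obtain \<Gamma>' where g: "\<Gamma> = braid_act s (braid_act s' \<Gamma>')" "\<Gamma>' \<turnstile> M" "strands s = length \<Gamma>'" "strands s' = length \<Gamma>'"
    by (auto elim!: wf_BrE)
  then show ?case using Br_mult wf_trm.Br[OF g(2), of "s \<odot> s'"] by (simp add: braid_act_mult)
next
  case (Br_App \<Gamma> s M s' N)
  then obtain \<Gamma>1 \<Gamma>2 where g: "\<Gamma> = braid_act s \<Gamma>1 @ braid_act s' \<Gamma>2" "\<Gamma>1 \<turnstile> M" "\<Gamma>2 \<turnstile> N"
    "strands s = length \<Gamma>1" "strands s' = length \<Gamma>2" "set (braid_act s \<Gamma>1) \<inter> set (braid_act s' \<Gamma>2) = {}"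
    by (auto elim!: wf_AppE wf_BrE)
  then have "\<Gamma>1 @ \<Gamma>2 \<turnstile> App M N" by (auto simp: set_braid_act intro: wf_trm.App)
  from wf_trm.Br[OF this, of "s \<otimes>\<^sub>b s'"] g Br_App show ?case by (simp add: braid_act_tensor)
next
  case (Br_Lam \<Gamma> s M)
  then obtain \<Gamma>' where g: "\<Gamma> = braid_act s \<Gamma>'" "map Suc \<Gamma>' @ [0] \<turnstile> M" "strands s = length \<Gamma>'"
    by (auto elim!: wf_BrE wf_LamE)
  then show ?case
    using Br_Lam wf_trm.Br[OF g(2), of "s \<otimes>\<^sub>b braid_one 1"]
    by (auto simp: braid_act_tensor braid_act_one braid_act_map intro!: wf_trm.Lam)
qed (auto intro: wf_trm.intros)

lemma combinatory_wf: "combinatory M \<Longrightarrow> [] \<turnstile> M"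
proof (induction rule: combinatory.induct)
  case B
  have "[2] @ ([1] @ [0]) \<turnstile> App (Var 2) (App (Var 1) (Var 0))" by (intro wf_trm.intros) auto
  then show ?case unfolding comb_B_def by (intro wf_trm.Lam) (simp add: numeral_2_eq_2)
next
  case I
  show ?case unfolding comb_I_def using wf_trm.Var[of 0] by (intro wf_trm.Lam) simp
next
  case C_plus
  have 1: "([2] @ [0]) @ [1] \<turnstile> App (App (Var 2) (Var 0)) (Var 1)" by (intro wf_trm.intros) auto
  have e: "braid_act (braid_one 1 \<otimes>\<^sub>b braid_gen 2 1 True) ([2] @ [0, 1]) = [2,1,0::nat]"
    by (subst braid_act_tensor) (auto simp: braid_act_one braid_act_def braid_perm_simps upt_rec)
  show ?case unfolding comb_C_plus_def
    using wf_trm.Br[OF 1, of "braid_one 1 \<otimes>\<^sub>b braid_gen 2 1 True"] e by (intro wf_trm.Lam) (simp add: numeral_2_eq_2)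
next
  case C_minus
  have 1: "([2] @ [0]) @ [1] \<turnstile> App (App (Var 2) (Var 0)) (Var 1)" by (intro wf_trm.intros) auto
  have e: "braid_act (braid_one 1 \<otimes>\<^sub>b braid_gen 2 1 False) ([2] @ [0, 1]) = [2,1,0::nat]"
    by (subst braid_act_tensor) (auto simp: braid_act_one braid_act_def braid_perm_simps upt_rec)
  show ?case unfolding comb_C_minus_def
    using wf_trm.Br[OF 1, of "braid_one 1 \<otimes>\<^sub>b braid_gen 2 1 False"] e by (intro wf_trm.Lam) (simp add: numeral_2_eq_2)
next
  case (App M N)
  then show ?case using wf_trm.App[of "[]" M "[]" N] by simp
qed

end

theory Submission
  imports Defs
begin

text \<open>Instead of eliminating one abstraction at a time, one shows by induction that every term with
  context \<open>x\<^sub>1, \<dots>, x\<^sub>n\<close> equals \<open>P x\<^sub>1 \<dots> x\<^sub>n\<close> for some combinatory \<open>P\<close>; abstracting the last variable is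
  then \<open>\<eta>\<close>. For applications, \<open>B\<close> composes and \<open>C I Q X = X Q\<close> passes closed arguments. For \<open>[s]\<close> one
  writes \<open>s\<close> as a word: after substituting \<open>f := P x\<^sub>1 \<dots> x\<^bsub>j-1\<^esub>\<close> the braid \<open>id\<^sub>1 \<otimes> \<sigma>\<^sub>1\<close> in \<open>C f y x\<close> becomes
  \<open>\<sigma>\<^sub>j\<close>, and the remaining variables are added as parallel strands.\<close>

section \<open>Lifting and substitution of de Bruijn indices\<close>

lemma ctx_lift: "\<Gamma> \<turnstile> M \<Longrightarrow> ctx (lift_trm k M) = map (lift_var k) \<Gamma>"
  by (rule ctx_eq) (rule lift_wf)

lemma lift_closed: "\<Gamma> \<turnstile> M \<Longrightarrow> \<forall>x \<in> set \<Gamma>. x < k \<Longrightarrow> lift_trm k M = M"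
proof (induction arbitrary: k rule: wf_trm.induct)
  case (Br \<Gamma> M s)
  then show ?case using set_braid_act[of s \<Gamma>] by simp
qed auto

lemma subst_lift: "\<Gamma> \<turnstile> M \<Longrightarrow> subst (lift_trm k M) k N = M"
proof (induction arbitrary: k N rule: wf_trm.induct)
  case (Br \<Gamma> M s)
  \<comment> \<open>Lifting skips the index \<open>k\<close>, so the substitution does not cable the
    braid.\<close>
  have "k \<notin> set (ctx (lift_trm k M))"
    unfolding ctx_lift[OF Br(1)] by (auto simp: lift_var_def)
  then show ?case using Br by simp
qed auto

lemma lift_lift: "i \<le> k \<Longrightarrow> lift_trm i (lift_trm k M) = lift_trm (Suc k) (lift_trm i M)"
  by (induction M arbitrary: i k) auto

text \<open>By \<open>lift_lift\<close> the outer lift can be taken at index 1 instead of 0, and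
  there \<open>subst_lift\<close> cancels it.\<close>

lemma subst_lift_lift:
  assumes "\<Gamma> \<turnstile> M"
  shows "subst (lift_trm 0 (lift_trm 0 M)) (Suc 0) N = lift_trm 0 M"
  using subst_lift[OF lift_wf[OF assms]] lift_lift[of 0 0 M] by simp

section \<open>Congruence and beta reduction in contexts\<close>

lemma beta_eta_congL:
  assumes "\<Gamma> \<turnstile> M =\<^sub>\<beta>\<^sub>\<eta> M'" "\<Gamma>' \<turnstile> N" "set \<Gamma> \<inter> set \<Gamma>' = {}"
  shows "\<Gamma> @ \<Gamma>' \<turnstile> App M N =\<^sub>\<beta>\<^sub>\<eta> App M' N"
  using assms by (auto intro: beta_eta.intros)

lemma beta_eta_congR:
  assumes "\<Gamma> \<turnstile> M" "\<Gamma>' \<turnstile> N =\<^sub>\<beta>\<^sub>\<eta> N'" "set \<Gamma> \<inter> set \<Gamma>' = {}"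
  shows "\<Gamma> @ \<Gamma>' \<turnstile> App M N =\<^sub>\<beta>\<^sub>\<eta> App M N'"
  using assms by (auto intro: beta_eta.intros)

lemma beta_closed:
  assumes "[] \<turnstile> Lam M" "\<Gamma> \<turnstile> N"
  shows "\<Gamma> \<turnstile> App (Lam M) N =\<^sub>\<beta>\<^sub>\<eta> subst M 0 N"
  using beta_eta.beta[of \<Gamma> M N] wf_trm.App[OF assms] by simp

lemma beta_app:
  assumes "\<Gamma> \<turnstile> M =\<^sub>\<beta>\<^sub>\<eta> Lam M'" "\<Delta> \<turnstile> N" "set \<Gamma> \<inter> set \<Delta> = {}"
  shows "\<Gamma> @ \<Delta> \<turnstile> App M N =\<^sub>\<beta>\<^sub>\<eta> subst M' 0 N"
  using beta_eta_congL[OF assms] beta_eta_wf beta_eta.beta beta_eta.trans by blast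

lemma comb_I_app: "\<Gamma> \<turnstile> M \<Longrightarrow> \<Gamma> \<turnstile> App comb_I M =\<^sub>\<beta>\<^sub>\<eta> M"
  using beta_closed[of "Var 0" \<Gamma> M] combinatory_wf[OF combinatory.I] by (simp add: comb_I_def)

text \<open>\<open>B\<close> keeps its arguments in order, so the contexts of both sides agree and
  no braid arises.\<close>

lemma comb_B_app:
  assumes "\<Gamma>1 \<turnstile> M" "\<Gamma>2 \<turnstile> N" "\<Gamma>3 \<turnstile> P"
    "set \<Gamma>1 \<inter> set \<Gamma>2 = {}" "(set \<Gamma>1 \<union> set \<Gamma>2) \<inter> set \<Gamma>3 = {}"
  shows "\<Gamma>1 @ \<Gamma>2 @ \<Gamma>3 \<turnstile> App (App (App comb_B M) N) P =\<^sub>\<beta>\<^sub>\<eta> App M (App N P)"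
proof -
  have "\<Gamma>1 \<turnstile> App comb_B M =\<^sub>\<beta>\<^sub>\<eta>
      Lam (Lam (App (lift_trm 0 (lift_trm 0 M)) (App (Var 1) (Var 0))))"
    using beta_closed[OF combinatory_wf[OF combinatory.B, unfolded comb_B_def] assms(1)]
    by (simp add: comb_B_def numeral_2_eq_2)
  from beta_app[OF this assms(2,4)]
  have "\<Gamma>1 @ \<Gamma>2 \<turnstile> App (App comb_B M) N =\<^sub>\<beta>\<^sub>\<eta> Lam (App (lift_trm 0 M) (App (lift_trm 0 N) (Var 0)))"
    by (simp add: subst_lift_lift[OF assms(1)])
  from beta_app[OF this assms(3)] show ?thesis
    using assms by (simp add: subst_lift[OF assms(1)] subst_lift[OF assms(2)])
qed


section \<open>The combinators C\<close>

lemma word_cable_1: "word_cable w i (Suc 0) = w"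
proof (induction w arbitrary: i)
  case (Cons g w)
  then show ?case by (cases g) auto
qed simp

text \<open>A variable is a single strand, so substituting it under a braid leaves the braid as it
  is.\<close>

lemma braid_cable_1: "braid_cable s i (Suc 0) = s"
proof -
  obtain n w where "braid_word n w" "s = abs_braid (n, w)" by (rule braid_cases)
  moreover from this have "braid_rel (n, w) (n, w)" by (simp add: braid_rel_def braid_eq.refl)
  ultimately show ?thesis by (simp add: braid_cable.abs_eq word_cable_1)
qed

lemma braid_cable_one:
  "1 \<le> i \<Longrightarrow> i \<le> n \<Longrightarrow> braid_cable (braid_one n) i m = braid_one (n + m - 1)"
  by transfer (auto simp: braid_rel_def intro: braid_eq.refl)

text \<open>Strand 1 runs to the left of the crossing, so replacing it only moves the crossing. This
  is what happens to the braid of \<open>C\<close> when the first argument has \<open>m\<close> free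
  variables.\<close>

lemma braid_cable_gen_first:
  "braid_cable (braid_gen 3 2 b) (Suc 0) m = braid_gen (m + 2) (m + 1) b"
  by transfer (auto simp: braid_rel_def intro!: braid_eq.refl)

text \<open>A crossing disappears once either of its two strands is deleted, which is the effect of
  a closed argument.\<close>

lemma braid_cable_gen_delete:
  "i = 1 \<or> i = 2 \<Longrightarrow> braid_cable (braid_gen 2 1 b) i 0 = braid_one 1"
  by transfer (auto simp: braid_rel_def intro!: braid_eq.refl)

lemma braid_one_tensor_gen: "braid_one 1 \<otimes>\<^sub>b braid_gen 2 1 b = braid_gen 3 2 b"
  by transfer (auto simp: braid_rel_def shift_word_def numeral_eq_Suc intro!: braid_eq.refl)

lemma braid_gen_tensor_one:
  "1 \<le> j \<Longrightarrow> j < n \<Longrightarrow> braid_gen n j b \<otimes>\<^sub>b braid_one k = braid_gen (n + k) j b"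
  by transfer (auto simp: braid_rel_def shift_word_def intro!: braid_eq.refl)

lemma inv_braid_perm_eq: "braid_perm s p = i \<Longrightarrow> inv (braid_perm s) i = p"
  using braid_perm_inject braid_perm_inv by metis

definition comb_C :: "bool \<Rightarrow> trm" where
  "comb_C b = (if b then comb_C_plus else comb_C_minus)"

lemma comb_C_eq:
  "comb_C b = Lam (Lam (Lam (Br (braid_gen 3 2 b) (App (App (Var 2) (Var 0)) (Var 1)))))"
  by (simp add: comb_C_def comb_C_plus_def comb_C_minus_def flip: braid_one_tensor_gen)

lemma combinatory_C: "combinatory (comb_C b)"
  by (simp add: comb_C_def combinatory.intros)

lemma comb_C_app1:
  assumes "\<Gamma> \<turnstile> M"
  shows "\<Gamma> \<turnstile> App (comb_C b) M =\<^sub>\<beta>\<^sub>\<eta> Lam (Lam (Br (braid_gen (length \<Gamma> + 2) (length \<Gamma> + 1) b)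
    (App (App (lift_trm 0 (lift_trm 0 M)) (Var 0)) (Var 1))))"
proof -
  \<comment> \<open>The list is the context of the body of \<open>C\<close>. Index 2, the first
    argument, stands at position 1, which \<sigma>_2 fixes, so strand 1 is the one cabled.\<close>
  have "position 2 [2, 0, Suc 0] = 1" using position_split[of 2 "[]" "[0, Suc 0]"] by simp
  moreover have "inv (braid_perm (braid_gen 3 2 b)) (Suc 0) = Suc 0"
    by (rule inv_braid_perm_eq) (simp add: braid_perm_simps transpose_def)
  moreover have "ctx (lift_trm 0 (lift_trm 0 M)) = map (lift_var 0) (map (lift_var 0) \<Gamma>)"
    by (intro ctx_lift lift_wf assms)
  ultimately show ?thesis
    using beta_closed[OF combinatory_wf[OF combinatory_C, of b, unfolded comb_C_eq] assms]
    by (simp add: comb_C_eq numeral_2_eq_2[symmetric] braid_cable_gen_first)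
qed

text \<open>The first argument has put the crossing on the last two strands; the two variables are
  single strands and leave it there by \<open>braid_cable_1\<close>.\<close>

lemma comb_C_app_vars:
  assumes "\<Gamma> \<turnstile> M" "distinct (\<Gamma> @ [x, y])"
  shows "\<Gamma> @ [x, y] \<turnstile> App (App (App (comb_C b) M) (Var x)) (Var y) =\<^sub>\<beta>\<^sub>\<eta>
    Br (braid_gen (length \<Gamma> + 2) (length \<Gamma> + 1) b) (App (App M (Var y)) (Var x))"
proof -
  let ?s = "braid_gen (length \<Gamma> + 2) (length \<Gamma> + 1) b"
  have "\<Gamma> @ [x] \<turnstile> App (App (comb_C b) M) (Var x) =\<^sub>\<beta>\<^sub>\<eta>
      Lam (Br ?s (App (App (lift_trm 0 M) (Var 0)) (Var (Suc x))))"
    using beta_app[OF comb_C_app1[OF assms(1)] wf_trm.Var[of x], of b] assms(2)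
    by (simp add: subst_lift_lift[OF assms(1)] braid_cable_1)
  from beta_app[OF this wf_trm.Var[of y]] show ?thesis
    using assms(2) by (simp add: subst_lift[OF assms(1)] braid_cable_1)
qed

text \<open>A closed argument carries no strands, so here the braiding of C is trivial.\<close>

lemma comb_C_app_closed:
  assumes "[] \<turnstile> N" "\<Gamma> \<turnstile> M"
  shows "\<Gamma> \<turnstile> App (App (App (comb_C b) comb_I) N) M =\<^sub>\<beta>\<^sub>\<eta> App M N"
proof -
  have I: "[] \<turnstile> comb_I" by (intro combinatory_wf combinatory.I)
  have l [simp]: "lift_trm k comb_I = comb_I" "lift_trm k N = N" for k
    using lift_closed I assms(1) by auto
  have s [simp]: "subst comb_I k L = comb_I" "subst N k L = N" for k L
    using subst_lift[OF I, of k L] subst_lift[OF assms(1), of k L] by simp_all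
  have c [simp]: "ctx comb_I = []" "ctx N = []" using ctx_eq I assms(1) by auto
  \<comment> \<open>\<open>N\<close> replaces index 1, which is second in the context of the body
    and hence belongs to the strand starting at position 1. Deleting that strand leaves
    \<open>braid_one 1\<close>.\<close>
  have "position (Suc 0) [0, Suc 0] = 2" using position_split[of "Suc 0" "[0]" "[]"] by simp
  moreover have "inv (braid_perm (braid_gen 2 (Suc 0) b)) 2 = Suc 0"
    by (rule inv_braid_perm_eq) (simp add: braid_perm_simps transpose_def)
  ultimately have 1: "[] \<turnstile> App (App (comb_C b) comb_I) N =\<^sub>\<beta>\<^sub>\<eta>
      Lam (Br (braid_one 1) (App (App comb_I (Var 0)) N))"
    using beta_app[OF comb_C_app1[OF I, of b] assms(1)] braid_cable_gen_delete[of "Suc 0" b]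
    by (simp flip: numeral_2_eq_2)
  \<comment> \<open>Cabling the one remaining strand by \<open>M\<close> gives the unit braid, which
    \<open>Br_one\<close> removes.\<close>
  have "position 0 [0::nat] = 1" using position_split[of 0 "[]" "[]"] by simp
  moreover have "inv (braid_perm (braid_one (Suc 0))) (Suc 0) = Suc 0"
    by (rule inv_braid_perm_eq) (simp add: braid_perm_simps)
  ultimately have 2: "\<Gamma> \<turnstile> App (App (App (comb_C b) comb_I) N) M =\<^sub>\<beta>\<^sub>\<eta>
      Br (braid_one (length \<Gamma>)) (App (App comb_I M) N)"
    using beta_app[OF 1 assms(2)] ctx_eq[OF assms(2)] by (simp add: braid_cable_one)
  have 3: "\<Gamma> \<turnstile> App (App comb_I M) N =\<^sub>\<beta>\<^sub>\<eta> App M N"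
    using beta_eta_congL[OF comb_I_app[OF assms(2)] assms(1)] by simp
  then have "\<Gamma> \<turnstile> App (App comb_I M) N" using beta_eta_wf by blast
  from beta_eta.trans[OF 2 beta_eta.trans[OF beta_eta.Br_one[OF this] 3]] show ?thesis .
qed


section \<open>Combinators applied to variables\<close>

definition spine :: "trm \<Rightarrow> nat list \<Rightarrow> trm" where
  "spine M xs = foldl App M (map Var xs)"

lemma spine_simps [simp]:
  "spine M [] = M"
  "spine M (xs @ ys) = spine (spine M xs) ys"
  "spine M (x # xs) = spine (App M (Var x)) xs"
  by (simp_all add: spine_def)

lemma spine_cong:
  assumes "\<Gamma> \<turnstile> M =\<^sub>\<beta>\<^sub>\<eta> N" "distinct (\<Gamma> @ xs)"
  shows "\<Gamma> @ xs \<turnstile> spine M xs =\<^sub>\<beta>\<^sub>\<eta> spine N xs"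
  using assms
proof (induction xs rule: rev_induct)
  case (snoc x xs)
  then have "\<Gamma> @ xs \<turnstile> spine M xs =\<^sub>\<beta>\<^sub>\<eta> spine N xs" by simp
  from beta_eta_congL[OF this wf_trm.Var[of x]] show ?case using snoc.prems by auto
qed simp

lemma spine_wf:
  assumes "\<Gamma> \<turnstile> M" "distinct (\<Gamma> @ xs)"
  shows "\<Gamma> @ xs \<turnstile> spine M xs"
  using spine_cong[OF beta_eta.refl] beta_eta_wf assms by blast

text \<open>The invariant of the induction on terms. The variables follow the order of the context
  and no braid surrounds the spine, so \<open>P\<close> itself has to encode every crossing.\<close>

definition represented :: "nat list \<Rightarrow> trm \<Rightarrow> bool" where
  "represented \<Gamma> M \<longleftrightarrow> (\<exists>P. combinatory P \<and> \<Gamma> \<turnstile> M =\<^sub>\<beta>\<^sub>\<eta> spine P \<Gamma>)"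

lemma represented_wf: "represented \<Gamma> M \<Longrightarrow> \<Gamma> \<turnstile> M"
  using beta_eta_wf by (auto simp: represented_def)

lemma represented_eq: "\<Gamma> \<turnstile> M =\<^sub>\<beta>\<^sub>\<eta> N \<Longrightarrow> represented \<Gamma> N \<Longrightarrow> represented \<Gamma> M"
  by (auto simp: represented_def intro: beta_eta.trans)

lemma represented_spine:
  assumes "represented \<Gamma> M" "distinct (\<Gamma> @ xs)"
  shows "represented (\<Gamma> @ xs) (spine M xs)"
  using assms spine_cong[of \<Gamma> M _ xs] by (auto simp: represented_def)

text \<open>Iterating \<open>B F (P x) y = F (P x y)\<close> moves the function \<open>F\<close> to the front.\<close>

lemma represented_App_closed:
  assumes "combinatory F" "represented \<Gamma> M"
  shows "represented \<Gamma> (App F M)"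
proof -
  have *: "\<exists>R. combinatory R \<and> \<Gamma> \<turnstile> App F (spine P \<Gamma>) =\<^sub>\<beta>\<^sub>\<eta> spine R \<Gamma>"
    if "combinatory F" "combinatory P" "distinct \<Gamma>" for F P
    using that
  proof (induction \<Gamma> arbitrary: F rule: rev_induct)
    case Nil
    then show ?case
      using combinatory.App combinatory_wf beta_eta.refl spine_simps(1) by metis
  next
    case (snoc x \<Gamma>)
    have P: "\<Gamma> \<turnstile> spine P \<Gamma>" using spine_wf[OF combinatory_wf, of P \<Gamma>] snoc.prems by simp
    have 1: "\<Gamma> @ [x] \<turnstile> App (App (App comb_B F) (spine P \<Gamma>)) (Var x) =\<^sub>\<beta>\<^sub>\<eta>
        App F (spine P (\<Gamma> @ [x]))"
      using comb_B_app[OF combinatory_wf P wf_trm.Var, of F x] snoc.prems by simp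
    \<comment> \<open>The hypothesis is applied to \<open>App comb_B F\<close>, which is why the
      induction generalises \<open>F\<close>.\<close>
    obtain R where R: "combinatory R" "\<Gamma> \<turnstile> App (App comb_B F) (spine P \<Gamma>) =\<^sub>\<beta>\<^sub>\<eta> spine R \<Gamma>"
      using snoc.IH[of "App comb_B F"] snoc.prems combinatory.B combinatory.App by auto
    have "\<Gamma> @ [x] \<turnstile> App (App (App comb_B F) (spine P \<Gamma>)) (Var x) =\<^sub>\<beta>\<^sub>\<eta> spine R (\<Gamma> @ [x])"
      using spine_cong[OF R(2), of "[x]"] snoc.prems by simp
    with 1 R(1) show ?case using beta_eta.sym beta_eta.trans by blast
  qed
  obtain P where P: "combinatory P" "\<Gamma> \<turnstile> M =\<^sub>\<beta>\<^sub>\<eta> spine P \<Gamma>"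
    using assms(2) by (auto simp: represented_def)
  have "distinct \<Gamma>" using wf_distinct represented_wf assms(2) by blast
  then obtain R where R: "combinatory R" "\<Gamma> \<turnstile> App F (spine P \<Gamma>) =\<^sub>\<beta>\<^sub>\<eta> spine R \<Gamma>"
    using *[OF assms(1) P(1)] by blast
  have "\<Gamma> \<turnstile> App F M =\<^sub>\<beta>\<^sub>\<eta> App F (spine P \<Gamma>)"
    using beta_eta_congR[OF combinatory_wf[OF assms(1)] P(2)] by simp
  then show ?thesis using R beta_eta.trans unfolding represented_def by blast
qed

text \<open>\<open>C I Q\<close> is a closed function that sends \<open>M\<close> to
  \<open>App M Q\<close>, so \<open>represented_App_closed\<close> applies. The choice of sign is
  arbitrary.\<close>

lemma represented_closed_arg:
  assumes "represented \<Gamma> M" "combinatory Q"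
  shows "represented \<Gamma> (App M Q)"
proof (rule represented_eq)
  show "represented \<Gamma> (App (App (App (comb_C True) comb_I) Q) M)"
    by (intro represented_App_closed combinatory.App combinatory_C combinatory.I assms)
  show "\<Gamma> \<turnstile> App M Q =\<^sub>\<beta>\<^sub>\<eta> App (App (App (comb_C True) comb_I) Q) M"
    by (intro beta_eta.sym[OF comb_C_app_closed] combinatory_wf represented_wf assms)
qed

text \<open>Since \<open>M (N y) = B M N y\<close>, the last variable of the argument can be moved
  outside while \<open>M\<close> grows to \<open>B M\<close>. When no variable is left the argument
  is closed.\<close>

lemma represented_App_spine:
  assumes "represented \<Gamma> M" "combinatory Q" "distinct (\<Gamma> @ \<Delta>)"
  shows "represented (\<Gamma> @ \<Delta>) (App M (spine Q \<Delta>))"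
  using assms(1,3)
proof (induction \<Delta> arbitrary: M rule: rev_induct)
  case Nil
  then show ?case using represented_closed_arg assms(2) by simp
next
  case (snoc y \<Delta>)
  have Q: "\<Delta> \<turnstile> spine Q \<Delta>" using spine_wf[OF combinatory_wf[OF assms(2)], of \<Delta>] snoc.prems by simp
  have "represented (\<Gamma> @ \<Delta>) (App (App comb_B M) (spine Q \<Delta>))"
    using snoc by (intro snoc.IH represented_App_closed combinatory.B) auto
  from represented_spine[OF this, of "[y]"]
  have "represented (\<Gamma> @ \<Delta> @ [y]) (App (App (App comb_B M) (spine Q \<Delta>)) (Var y))"
    using snoc.prems by simp
  moreover have "\<Gamma> @ \<Delta> @ [y] \<turnstile> App (App (App comb_B M) (spine Q \<Delta>)) (Var y) =\<^sub>\<beta>\<^sub>\<eta>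
      App M (App (spine Q \<Delta>) (Var y))"
    using snoc.prems by (intro comb_B_app Q wf_trm.Var represented_wf) auto
  ultimately have "represented (\<Gamma> @ \<Delta> @ [y]) (App M (App (spine Q \<Delta>) (Var y)))"
    using represented_eq beta_eta.sym by blast
  then show ?case by simp
qed

lemma represented_App:
  assumes "represented \<Gamma> M" "represented \<Delta> N" "set \<Gamma> \<inter> set \<Delta> = {}"
  shows "represented (\<Gamma> @ \<Delta>) (App M N)"
proof -
  obtain Q where Q: "combinatory Q" "\<Delta> \<turnstile> N =\<^sub>\<beta>\<^sub>\<eta> spine Q \<Delta>"
    using assms(2) by (auto simp: represented_def)
  have "distinct (\<Gamma> @ \<Delta>)" using assms(3) wf_distinct[OF represented_wf[OF assms(1)]]
    wf_distinct[OF represented_wf[OF assms(2)]] by simp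
  from represented_App_spine[OF assms(1) Q(1) this] show ?thesis
    using represented_eq beta_eta_congR[OF represented_wf[OF assms(1)] Q(2) assms(3)] by blast
qed


section \<open>Braids\<close>

lemma braid_act_gen:
  "braid_act (braid_gen (length A + 2 + length C) (Suc (length A)) b) (A @ x # y # C) = A @ y # x # C"
proof (rule nth_equalityI)
  fix k
  assume "k < length (braid_act (braid_gen (length A + 2 + length C) (Suc (length A)) b) (A @ x # y # C))"
  then show "braid_act (braid_gen (length A + 2 + length C) (Suc (length A)) b) (A @ x # y # C) ! k
      = (A @ y # x # C) ! k"
    by (auto simp: braid_act_nth braid_perm_simps transpose_def nth_append nth_Cons')
qed simp

text \<open>Each further variable is written as \<open>[id] x\<close>, so that \<open>Br_App\<close>
  merges the two braids; tensoring with a unit keeps the generator and adds a strand.\<close>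

lemma spine_Br:
  assumes "\<Gamma> \<turnstile> M" "distinct (\<Gamma> @ xs)" "1 \<le> j" "j < length \<Gamma>"
  shows "braid_act (braid_gen (length \<Gamma>) j b) \<Gamma> @ xs \<turnstile>
    spine (Br (braid_gen (length \<Gamma>) j b) M) xs =\<^sub>\<beta>\<^sub>\<eta>
    Br (braid_gen (length \<Gamma> + length xs) j b) (spine M xs)"
  using assms(2)
proof (induction xs rule: rev_induct)
  case Nil
  then show ?case using wf_trm.Br[OF assms(1)] beta_eta.refl by simp
next
  case (snoc x xs)
  let ?\<Gamma> = "braid_act (braid_gen (length \<Gamma>) j b) \<Gamma> @ xs"
  let ?s = "braid_gen (length \<Gamma> + length xs) j b"
  have x: "x \<notin> set ?\<Gamma>" using snoc.prems by (simp add: set_braid_act)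
  have 1: "?\<Gamma> \<turnstile> spine (Br (braid_gen (length \<Gamma>) j b) M) xs =\<^sub>\<beta>\<^sub>\<eta> Br ?s (spine M xs)"
    using snoc by simp
  have "[x] \<turnstile> Var x =\<^sub>\<beta>\<^sub>\<eta> Br (braid_one 1) (Var x)"
    using beta_eta.sym[OF beta_eta.Br_one[OF wf_trm.Var[of x]]] by simp
  from beta_eta.App[OF 1 this] x
  have 2: "?\<Gamma> @ [x] \<turnstile> App (spine (Br (braid_gen (length \<Gamma>) j b) M) xs) (Var x) =\<^sub>\<beta>\<^sub>\<eta>
      App (Br ?s (spine M xs)) (Br (braid_one 1) (Var x))" by simp
  then have "?\<Gamma> @ [x] \<turnstile> App (Br ?s (spine M xs)) (Br (braid_one 1) (Var x))"
    using beta_eta_wf by blast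
  from beta_eta.trans[OF 2 beta_eta.Br_App[OF this]] show ?case
    using assms(3,4) braid_gen_tensor_one[of j "length \<Gamma> + length xs" b 1] by simp
qed

text \<open>With \<open>A\<close> the variables before the crossing, \<open>C (P A) y x\<close>
  equals \<open>[s] (P A x y)\<close> for the generator \<open>s\<close> crossing the last two
  strands. The variables after the crossing are added on both sides.\<close>

lemma represented_Br_gen:
  assumes "represented \<Gamma> M" "1 \<le> j" "j < length \<Gamma>"
  shows "represented (braid_act (braid_gen (length \<Gamma>) j b) \<Gamma>) (Br (braid_gen (length \<Gamma>) j b) M)"
proof -
  obtain P where P: "combinatory P" "\<Gamma> \<turnstile> M =\<^sub>\<beta>\<^sub>\<eta> spine P \<Gamma>"
    using assms(1) by (auto simp: represented_def)
  \<comment> \<open>Strands are counted from 1 and list entries from 0, so the crossing exchanges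
    the entries \<open>j - 1\<close> and \<open>j\<close>.\<close>
  define A where "A = take (j - 1) \<Gamma>"
  define C where "C = drop (Suc j) \<Gamma>"
  define x where "x = \<Gamma> ! (j - 1)"
  define y where "y = \<Gamma> ! j"
  have G: "\<Gamma> = A @ x # y # C"
    using assms(2,3) id_take_nth_drop[of "j - 1" \<Gamma>] Cons_nth_drop_Suc[of j \<Gamma>]
    by (simp add: A_def C_def x_def y_def)
  have A: "j = Suc (length A)" using assms(2,3) by (simp add: A_def)
  have d: "distinct (A @ x # y # C)" using wf_distinct represented_wf assms(1) G by blast
  let ?s = "braid_gen (length A + 2) j b"
  have wfA: "A \<turnstile> spine P A" using spine_wf[OF combinatory_wf[OF P(1)], of A] d by simp
  have wf: "A @ [x, y] \<turnstile> App (App (spine P A) (Var x)) (Var y)"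
    using spine_wf[OF wfA, of "[x, y]"] d by simp
  have "represented A (App (comb_C b) (spine P A))"
  proof (intro represented_App_closed combinatory_C)
    show "represented A (spine P A)"
      using P(1) beta_eta.refl[OF wfA] by (auto simp: represented_def)
  qed
  \<comment> \<open>The variables come in the order of the context after the crossing.\<close>
  from represented_spine[OF this, of "[y, x]"]
  have "represented (A @ [y, x]) (App (App (App (comb_C b) (spine P A)) (Var y)) (Var x))"
    using d by simp
  moreover have "A @ [y, x] \<turnstile> App (App (App (comb_C b) (spine P A)) (Var y)) (Var x) =\<^sub>\<beta>\<^sub>\<eta>
      Br ?s (App (App (spine P A) (Var x)) (Var y))"
    using comb_C_app_vars[OF wfA, of y x b] d by (auto simp: A)
  ultimately have "represented (A @ [y, x]) (Br ?s (App (App (spine P A) (Var x)) (Var y)))"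
    using represented_eq beta_eta.sym by blast
  from represented_spine[OF this, of C]
  have "represented (A @ y # x # C) (spine (Br ?s (App (App (spine P A) (Var x)) (Var y))) C)"
    using d by auto
  \<comment> \<open>\<open>spine_Br\<close> extends the generator from \<open>length A + 2\<close>
    strands to all of \<Gamma>.\<close>
  moreover have "A @ y # x # C \<turnstile> spine (Br ?s (App (App (spine P A) (Var x)) (Var y))) C =\<^sub>\<beta>\<^sub>\<eta>
      Br (braid_gen (length \<Gamma>) j b) (spine P \<Gamma>)"
    using spine_Br[OF wf, of C j b] braid_act_gen[of A "[]" b x y] d by (simp add: A G)
  ultimately have "represented (A @ y # x # C) (Br (braid_gen (length \<Gamma>) j b) (spine P \<Gamma>))"
    using represented_eq beta_eta.sym by blast
  moreover have "braid_act (braid_gen (length \<Gamma>) j b) \<Gamma> = A @ y # x # C"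
    using braid_act_gen[of A C b x y] by (simp add: A G)
  ultimately show ?thesis
    using represented_eq[OF beta_eta.Br[OF P(2), of "braid_gen (length \<Gamma>) j b"]] by simp
qed

section \<open>Arbitrary braids, letter by letter\<close>

lemma abs_braid_Nil: "abs_braid (n, []) = braid_one n"
  by (simp add: braid_one.abs_eq)

lemma abs_braid_Cons:
  assumes "braid_word n ((j, b) # w)"
  shows "abs_braid (n, (j, b) # w) = braid_gen n j b \<odot> abs_braid (n, w)"
proof -
  have "braid_rel (n, w) (n, w)" "braid_rel (n, [(j, b)]) (n, [(j, b)])"
    using assms by (auto simp: braid_rel_def intro!: braid_eq.refl)
  then show ?thesis using assms by (simp add: braid_gen.abs_eq braid_mult.abs_eq)
qed

lemma strands_abs_braid: "braid_word n w \<Longrightarrow> strands (abs_braid (n, w)) = n"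
  by (simp add: strands.abs_eq braid_rel_def braid_eq.refl)

text \<open>Induction on a word for \<open>s\<close>. By \<open>Br_mult\<close> the first letter
  acts outermost, on the context already permuted by the rest of the word, so
  \<open>represented_Br_gen\<close> handles it.\<close>

lemma represented_Br:
  assumes "represented \<Gamma> M" "strands s = length \<Gamma>"
  shows "represented (braid_act s \<Gamma>) (Br s M)"
proof -
  have *: "represented (braid_act (abs_braid (length \<Gamma>, w)) \<Gamma>) (Br (abs_braid (length \<Gamma>, w)) M)"
    if "braid_word (length \<Gamma>) w" for w
    using that
  proof (induction w)
    case Nil
    show ?case
      using represented_eq[OF beta_eta.Br_one[OF represented_wf] assms(1)] assms(1)
      by (simp add: abs_braid_Nil braid_act_one)
  next
    case (Cons g w)
    obtain j b where g: "g = (j, b)" by force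
    let ?s = "abs_braid (length \<Gamma>, w)" and ?t = "braid_gen (length \<Gamma>) j b"
    have s: "strands ?s = length \<Gamma>" using strands_abs_braid Cons.prems by simp
    have r: "represented (braid_act ?t (braid_act ?s \<Gamma>)) (Br ?t (Br ?s M))"
      using represented_Br_gen[of "braid_act ?s \<Gamma>" "Br ?s M" j b] Cons g by simp
    then have "represented (braid_act ?t (braid_act ?s \<Gamma>)) (Br (?t \<odot> ?s) M)"
      using represented_eq[OF beta_eta.sym[OF beta_eta.Br_mult[OF represented_wf]]] by blast
    then show ?case
      using Cons.prems g s by (simp add: abs_braid_Cons braid_act_mult)
  qed
  obtain n w where "braid_word n w" "s = abs_braid (n, w)" "strands s = n" by (rule braid_cases)
  then show ?thesis using * assms(2) by simp
qed

section \<open>Abstraction and the induction on terms\<close>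

lemma represented_Lam:
  assumes "represented (map Suc \<Gamma> @ [0]) M"
  shows "represented \<Gamma> (Lam M)"
proof -
  obtain P where P: "combinatory P" "map Suc \<Gamma> @ [0] \<turnstile> M =\<^sub>\<beta>\<^sub>\<eta> spine P (map Suc \<Gamma> @ [0])"
    using assms by (auto simp: represented_def)
  have "distinct \<Gamma>"
    using wf_distinct[OF represented_wf[OF assms]] by (simp add: distinct_map)
  then have "\<Gamma> \<turnstile> spine P \<Gamma>" using spine_wf[OF combinatory_wf[OF P(1)], of \<Gamma>] by simp
  \<comment> \<open>\<open>P\<close> is closed, so lifting only shifts the variables. The bound
    variable is the last argument of the spine, which makes the abstraction an eta redex.\<close>
  moreover have "lift_trm 0 (spine P \<Gamma>) = spine P (map Suc \<Gamma>)"
    by (induction \<Gamma> rule: rev_induct) (simp_all add: lift_closed[OF combinatory_wf[OF P(1)]])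
  ultimately have "\<Gamma> \<turnstile> Lam (spine P (map Suc \<Gamma> @ [0])) =\<^sub>\<beta>\<^sub>\<eta> spine P \<Gamma>"
    using beta_eta.eta[of \<Gamma> "spine P \<Gamma>"] by simp
  then show ?thesis
    using P beta_eta.Lam beta_eta.trans unfolding represented_def by blast
qed

lemma represented_term: "\<Gamma> \<turnstile> M \<Longrightarrow> represented \<Gamma> M"
proof (induction rule: wf_trm.induct)
  case (Var x)
  have "[x] \<turnstile> Var x =\<^sub>\<beta>\<^sub>\<eta> spine comb_I [x]"
    using beta_eta.sym[OF comb_I_app[OF wf_trm.Var]] by simp
  then show ?case using combinatory.I by (auto simp: represented_def)
qed (auto intro: represented_Lam represented_App represented_Br)

theorem theorem4:
  fixes M :: trm
  assumes "[] \<turnstile> M"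
  shows "\<exists>P. combinatory P \<and> [] \<turnstile> M =\<^sub>\<beta>\<^sub>\<eta> P"
  \<comment> \<open>For the empty context the spine is \<open>P\<close> alone.\<close>
  using represented_term[OF assms] by (simp add: represented_def)

end
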